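(* Let $\mathcal{M}$ be an $\mathcal{L}$-structure with $\mathcal{M}\models\mathsf{KP}+\mathsf{Powerset}+\Delta_0^{\mathcal{P}}\text{-}\mathsf{Collection}+\Sigma_1^{\mathcal{P}}\text{-}\mathsf{Foundation}$. Then there is an interpretation of the function symbol $\mathsf{P}$ in the admissible cover $\mathbb{C}\mathrm{ov}_{\mathcal{M}}$ such that the resulting $\mathcal{L}^*_{\mathsf{P}}$-expansion of $\mathbb{C}\mathrm{ov}_{\mathcal{M}}$ is the power admissible set $\mathbb{C}\mathrm{ov}^{\mathsf{P}}_{\mathcal{M}}$.
   Context: $\mathcal{L}=\{\in,=\}$. $\Delta_0$: closure under propositional connectives and quantifiers bounded by $\in$; $\Sigma_1,\Pi_1$ add a block of unbounded $\exists$, resp. $\forall$. $\Delta_0^{\mathcal{P}}$: smallest class of $\mathcal{L}$-formulae closed under propositional connectives and quantifiers $\mathcal{Q}x\in y$, $\mathcal{Q}x\subseteq y$ ($x,y$ distinct variables); $\Sigma_1^{\mathcal{P}}$ adds unbounded $\exists$'s in front. $\Gamma$-Separation, $\Gamma$-Collection are the usual schemes restricted to $\phi\in\Gamma$ (with parameters; collection: $(\forall x\in w)\exists y\,\phi\Rightarrow\exists C(\forall x\in w)(\exists y\in C)\phi$). $\Gamma$-Foundation: $\exists x\,\phi(x,\vec z)\Rightarrow\exists y(\phi(y,\vec z)\wedge(\forall x\in y)\neg\phi(x,\vec z))$ for $\phi\in\Gamma$. $\mathsf{KP}$: Extensionality, Pair, Union, $\Delta_0$-Separation, $\Delta_0$-Collection,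 $\Pi_1$-Foundation. $\mathcal{L}^*$ is $\mathcal{L}$ plus a binary relation $\mathsf{E}$, a unary predicate $\mathsf{U}$ (urelements) and a unary function symbol $\mathsf{F}$; $\mathcal{L}^*_{\mathsf{P}}$ adds a unary function symbol $\mathsf{P}$. Variables $p,q$ range over urelements (elements satisfying $\mathsf{U}$), $a,b$ over sets (elements satisfying $\neg\mathsf{U}$), $x,y,z$ over everything. An $\mathcal{L}^*_{\mathsf{P}}$-structure is written $\langle\mathcal{M};A,\in^{\mathfrak A},\mathsf{F}^{\mathfrak A},\mathsf{P}^{\mathfrak A}\rangle$ with $\mathcal{M}=\langle M,\mathsf{E}^{\mathfrak A}\rangle$, $M$ the extension of $\mathsf{U}$ and $A$ that of $\neg\mathsf{U}$; $\mathsf{E}^{\mathfrak A}\subseteq M\times M$, $\in^{\mathfrak A}\subseteq(M\cup A)\times A$. $\mathcal{L}^*$-structures are written likewise without $\mathsf{P}$. For $\mathcal{L}'\in\{\mathcal{L}^*,\mathcal{L}^*_{\mathsf{P}}\}$, $\Delta_0(\mathcal{L}')$ is the closure of the atomic $\mathcal{L}'$-formulae under connectives and quantifiers $\exists x\in t$, $\forall x\in t$, $t$ an $\mathcal{L}'$-term not containing $x$; $\Pi_1(\mathcal{L}')$ adds unbounded $\forall$'s. $\mathsf{KPU}_{\mathbb{C}\mathrm{ov}}$ ($\mathcal{L}^*$-theory): $\exists a(a=a)$; $\forall p\forall x(x\notin p)$; Extensionality for sets; Pair ($\forall x\forall y\exists a\forall z(z\in a\iff z=x\vee z=y)$); Union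 ($\forall a\exists b(\forall y\in a)(\forall x\in y)(x\in b)$); $\Delta_0(\mathcal{L}^* )$-Separation; $\Delta_0(\mathcal{L}^* )$-Collection; $\Pi_1(\mathcal{L}^* )$-Foundation; and $\forall p\forall x(x\,\mathsf{E}\,p\iff x\in\mathsf{F}(p))\wedge\forall a(\mathsf{F}(a)=\emptyset)$. $\mathsf{KPU}^{\mathcal{P}}_{\mathbb{C}\mathrm{ov}}$ ($\mathcal{L}^*_{\mathsf{P}}$-theory): $\mathsf{KPU}_{\mathbb{C}\mathrm{ov}}$ plus $\forall a\forall b(b\in\mathsf{P}(a)\iff b\subseteq a)$, $\Delta_0(\mathcal{L}^*_{\mathsf{P}})$-Separation, $\Delta_0(\mathcal{L}^*_{\mathsf{P}})$-Collection and $\Pi_1(\mathcal{L}^*_{\mathsf{P}})$-Foundation. An admissible (resp. power admissible) set covering $\mathcal{M}$ is a model $\langle\mathcal{M};A,\in^{\mathfrak A},\mathsf{F}^{\mathfrak A}\rangle$ of $\mathsf{KPU}_{\mathbb{C}\mathrm{ov}}$ (resp. $\langle\mathcal{M};A,\in^{\mathfrak A},\mathsf{F}^{\mathfrak A},\mathsf{P}^{\mathfrak A}\rangle$ of $\mathsf{KPU}^{\mathcal{P}}_{\mathbb{C}\mathrm{ov}}$) with $\in^{\mathfrak A}$ well-founded. $\mathbb{C}\mathrm{ov}_{\mathcal{M}}=\langle\mathcal{M};A_{\mathcal{M}},\in,\mathsf{F}_{\mathcal{M}}\rangle$ (resp. $\mathbb{C}\mathrm{ov}^{\mathsf{P}}_{\mathcal{M}}$)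 denotes the smallest (with respect to the collection of sets $A$) admissible (resp. power admissible) set covering $\mathcal{M}$ whose membership relation is that of the metatheory, elements of $M$ being treated as urelements. *)

theory Defs
  imports Main
begin

section \<open>The universe of sets over urelements\<close>

text \<open>
  The sets of the metatheory over a class of urelements \<open>'m\<close> are represented by well-founded trees
  modulo extensional equality.  The branching type is \<open>'m + nat + 'k\<close>, so \<open>('m, 'k) V\<close> consists of
  the urelements and of all sets over them that are hereditarily of cardinality at most
  \<open>|'m| + \<aleph>\<^sub>0 + |'k|\<close>.  The parameter \<open>'k\<close> is arbitrary and only serves to make the universe as large
  as desired.
\<close>

datatype ('m, 'k) tree =
  Leaf 'm
| Node "('m + nat + 'k) set" "'m + nat + 'k \<Rightarrow> ('m, 'k) tree"

inductive teq :: "('m, 'k) tree \<Rightarrow> ('m, 'k) tree \<Rightarrow> bool" where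
  leaf: "teq (Leaf p) (Leaf p)"
| node: "(\<And>i. i \<in> I \<Longrightarrow> \<exists>j\<in>J. teq (f i) (g j)) \<Longrightarrow>
         (\<And>j. j \<in> J \<Longrightarrow> \<exists>i\<in>I. teq (f i) (g j)) \<Longrightarrow> teq (Node I f) (Node J g)"

lemma teq_leaf_iff [simp]: "teq (Leaf p) u \<longleftrightarrow> u = Leaf p" "teq u (Leaf p) \<longleftrightarrow> u = Leaf p"
  by (auto elim: teq.cases intro: teq.intros)

lemma teq_node_iff: "teq (Node I f) (Node J g) \<longleftrightarrow>
  (\<forall>i\<in>I. \<exists>j\<in>J. teq (f i) (g j)) \<and> (\<forall>j\<in>J. \<exists>i\<in>I. teq (f i) (g j))"
  by (subst teq.simps) auto

lemma teq_refl: "teq t t"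
  by (induction t) (auto intro!: teq.intros)

lemma teq_sym: "teq t u \<Longrightarrow> teq u t"
proof (induction rule: teq.induct)
  case (node I J f g)
  show ?case unfolding teq_node_iff using node by blast
qed simp

lemma teq_trans: "teq t u \<Longrightarrow> teq u v \<Longrightarrow> teq t v"
proof (induction arbitrary: v rule: teq.induct)
  case (node I J f g)
  from node.prems show ?case
  proof (cases v)
    case (Node K h)
    show ?thesis unfolding Node teq_node_iff
      using node.prems node.IH unfolding Node teq_node_iff by meson
  qed auto
qed simp

quotient_type ('m, 'k) V = "('m, 'k) tree" / teq
  by (intro equivpI reflpI sympI transpI) (blast intro: teq_refl teq_sym teq_trans)+

lift_definition Ur :: "'m \<Rightarrow> ('m, 'k) V" is Leaf .

lift_definition vmem :: "('m, 'k) V \<Rightarrow> ('m, 'k) V \<Rightarrow> bool"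
  is "\<lambda>t u. case u of Leaf p \<Rightarrow> False | Node I f \<Rightarrow> \<exists>i\<in>I. teq t (f i)"
  by (auto split: tree.splits simp: teq_node_iff) (meson teq_sym teq_trans)+

lemma Ur_inject [simp]: "Ur p = Ur q \<longleftrightarrow> p = q"
  by transfer simp

lemma not_vmem_Ur [simp]: "\<not> vmem x (Ur p)"
  by transfer simp

lemma V_extensionality:
  assumes "a \<notin> range Ur" "b \<notin> range Ur" "\<And>x. vmem x a \<longleftrightarrow> vmem x b"
  shows "a = b"
proof -
  have "(\<forall>p. a \<noteq> Ur p) \<Longrightarrow> (\<forall>p. b \<noteq> Ur p) \<Longrightarrow> (\<forall>x. vmem x a \<longleftrightarrow> vmem x b) \<Longrightarrow> a = b"
  proof (transfer, goal_cases)
    case (1 a b)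
    obtain I f J g where ab: "a = Node I f" "b = Node J g"
      using 1 by (metis teq_refl tree.exhaust)
    show ?case
      using 1(3) unfolding ab teq_node_iff by simp (meson teq_refl teq_sym)
  qed
  with assms show ?thesis by blast
qed

lemma V_induct:
  fixes x :: "('m, 'k) V"
  assumes "\<And>x. (\<And>y. vmem y x \<Longrightarrow> Q y) \<Longrightarrow> Q x"
  shows "Q x"
proof -
  have "Q (abs_V t)" for t :: "('m, 'k) tree"
  proof (induction t)
    case (Leaf p)
    show ?case by (rule assms) (simp flip: Ur.abs_eq)
  next
    case (Node I f)
    show ?case
    proof (rule assms)
      fix y :: "('m, 'k) V"
      assume "vmem y (abs_V (Node I f))"
      then obtain i where "y = abs_V (f i)"
        by (induction y rule: V.abs_induct) (auto simp: vmem.abs_eq V.abs_eq_iff)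
      with Node show "Q y" by simp
    qed
  qed
  then show ?thesis by (induction x rule: V.abs_induct) simp
qed

lemma wf_vmem: "wf {(x, y :: ('m, 'k) V). vmem x y}"
proof (rule wfUNIVI)
  fix Q :: "('m, 'k) V \<Rightarrow> bool" and x
  assume "\<forall>x. (\<forall>y. (y, x) \<in> {(x, y). vmem x y} \<longrightarrow> Q y) \<longrightarrow> Q x"
  then show "Q x" by - (rule V_induct[of Q], simp)
qed

lemma V_comprehension:
  fixes h :: "'m + nat + 'k \<Rightarrow> ('m, 'k) V"
  shows "\<exists>a. a \<notin> range Ur \<and> (\<forall>x. vmem x a \<longleftrightarrow> x \<in> h ` I)"
proof -
  let ?a = "abs_V (Node I (\<lambda>i. rep_V (h i)))"
  have "?a \<notin> range Ur"
    by (auto simp: Ur.abs_eq V.abs_eq_iff)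
  moreover have "vmem x ?a \<longleftrightarrow> x \<in> h ` I" for x
  proof -
    have "vmem (abs_V (rep_V x)) ?a \<longleftrightarrow> (\<exists>i\<in>I. teq (rep_V x) (rep_V (h i)))"
      by (simp add: vmem.abs_eq)
    then show ?thesis
      by (auto simp: Quotient3_abs_rep[OF Quotient3_V] Quotient3_rel_rep[OF Quotient3_V])
  qed
  ultimately show ?thesis by blast
qed


section \<open>Axiom schemes\<close>

text \<open>
  The instances of a scheme for a class \<open>\<Gamma>\<close> of formulae in a structure with domain \<open>D\<close>, sets
  \<open>S \<subseteq> D\<close> (\<open>S = D\<close> if there are no urelements) and membership \<open>m\<close>.  The predicate \<open>sat\<close> is
  satisfaction of a formula under an assignment of the variables; the assignment \<open>s\<close> supplies the
  parameters.
\<close>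

definition separation ::
  "'u set \<Rightarrow> 'u set \<Rightarrow> ('u \<Rightarrow> 'u \<Rightarrow> bool) \<Rightarrow> ('p \<Rightarrow> (nat \<Rightarrow> 'u) \<Rightarrow> bool) \<Rightarrow> 'p set \<Rightarrow> bool" where
  "separation D S m sat \<Gamma> \<longleftrightarrow>
     (\<forall>\<phi>\<in>\<Gamma>. \<forall>s i. range s \<subseteq> D \<longrightarrow>
        (\<forall>a\<in>S. \<exists>b\<in>S. \<forall>x\<in>D. m x b \<longleftrightarrow> m x a \<and> sat \<phi> (s(i := x))))"

definition collection ::
  "'u set \<Rightarrow> 'u set \<Rightarrow> ('u \<Rightarrow> 'u \<Rightarrow> bool) \<Rightarrow> ('p \<Rightarrow> (nat \<Rightarrow> 'u) \<Rightarrow> bool) \<Rightarrow> 'p set \<Rightarrow> bool" where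
  "collection D S m sat \<Gamma> \<longleftrightarrow>
     (\<forall>\<phi>\<in>\<Gamma>. \<forall>s i j. range s \<subseteq> D \<longrightarrow> i \<noteq> j \<longrightarrow>
        (\<forall>a\<in>S. (\<forall>x\<in>D. m x a \<longrightarrow> (\<exists>y\<in>D. sat \<phi> (s(i := x, j := y)))) \<longrightarrow>
           (\<exists>c\<in>S. \<forall>x\<in>D. m x a \<longrightarrow> (\<exists>y\<in>D. m y c \<and> sat \<phi> (s(i := x, j := y))))))"

definition foundation ::
  "'u set \<Rightarrow> ('u \<Rightarrow> 'u \<Rightarrow> bool) \<Rightarrow> ('p \<Rightarrow> (nat \<Rightarrow> 'u) \<Rightarrow> bool) \<Rightarrow> 'p set \<Rightarrow> bool" where
  "foundation D m sat \<Gamma> \<longleftrightarrow>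
     (\<forall>\<phi>\<in>\<Gamma>. \<forall>s i. range s \<subseteq> D \<longrightarrow>
        (\<exists>x\<in>D. sat \<phi> (s(i := x))) \<longrightarrow>
        (\<exists>y\<in>D. sat \<phi> (s(i := y)) \<and> (\<forall>x\<in>D. m x y \<longrightarrow> \<not> sat \<phi> (s(i := x)))))"


section \<open>The language of set theory and KP\<close>

text \<open>
  An \<open>\<L>\<close>-structure is a type \<open>'m\<close> together with a binary relation.  Variables are natural numbers;
  the remaining connectives and the universal quantifier are abbreviations, so every class of
  formulae below that is closed under negation is closed under both kinds of bounded quantifier.
\<close>

datatype lfm = LMem nat nat | LEq nat nat | LNeg lfm | LAnd lfm lfm | LEx nat lfm

abbreviation LAll :: "nat \<Rightarrow> lfm \<Rightarrow> lfm" where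
  "LAll x \<phi> \<equiv> LNeg (LEx x (LNeg \<phi>))"

definition LSub :: "nat \<Rightarrow> nat \<Rightarrow> lfm" where
  "LSub x y = (let z = Suc (max x y) in LAll z (LNeg (LAnd (LMem z x) (LNeg (LMem z y)))))"

primrec lsat :: "('m \<Rightarrow> 'm \<Rightarrow> bool) \<Rightarrow> lfm \<Rightarrow> (nat \<Rightarrow> 'm) \<Rightarrow> bool" where
  "lsat E (LMem x y) s \<longleftrightarrow> E (s x) (s y)"
| "lsat E (LEq x y) s \<longleftrightarrow> s x = s y"
| "lsat E (LNeg \<phi>) s \<longleftrightarrow> \<not> lsat E \<phi> s"
| "lsat E (LAnd \<phi> \<psi>) s \<longleftrightarrow> lsat E \<phi> s \<and> lsat E \<psi> s"
| "lsat E (LEx x \<phi>) s \<longleftrightarrow> (\<exists>v. lsat E \<phi> (s(x := v)))"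

lemma lsat_LSub [simp]: "lsat E (LSub x y) s \<longleftrightarrow> (\<forall>z. E z (s x) \<longrightarrow> E z (s y))"
proof -
  have "x \<noteq> Suc (max x y)" "y \<noteq> Suc (max x y)" by auto
  then show ?thesis by (simp add: LSub_def Let_def)
qed

inductive_set LDelta0 :: "lfm set" where
  "LMem x y \<in> LDelta0"
| "LEq x y \<in> LDelta0"
| "\<phi> \<in> LDelta0 \<Longrightarrow> LNeg \<phi> \<in> LDelta0"
| "\<phi> \<in> LDelta0 \<Longrightarrow> \<psi> \<in> LDelta0 \<Longrightarrow> LAnd \<phi> \<psi> \<in> LDelta0"
| "x \<noteq> y \<Longrightarrow> \<phi> \<in> LDelta0 \<Longrightarrow> LEx x (LAnd (LMem x y) \<phi>) \<in> LDelta0"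

inductive_set LPi1 :: "lfm set" where
  "\<phi> \<in> LDelta0 \<Longrightarrow> \<phi> \<in> LPi1"
| "\<phi> \<in> LPi1 \<Longrightarrow> LAll x \<phi> \<in> LPi1"

inductive_set LDelta0P :: "lfm set" where
  "LMem x y \<in> LDelta0P"
| "LEq x y \<in> LDelta0P"
| "\<phi> \<in> LDelta0P \<Longrightarrow> LNeg \<phi> \<in> LDelta0P"
| "\<phi> \<in> LDelta0P \<Longrightarrow> \<psi> \<in> LDelta0P \<Longrightarrow> LAnd \<phi> \<psi> \<in> LDelta0P"
| "x \<noteq> y \<Longrightarrow> \<phi> \<in> LDelta0P \<Longrightarrow> LEx x (LAnd (LMem x y) \<phi>) \<in> LDelta0P"
| "x \<noteq> y \<Longrightarrow> \<phi> \<in> LDelta0P \<Longrightarrow> LEx x (LAnd (LSub x y) \<phi>) \<in> LDelta0P"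

inductive_set LSigma1P :: "lfm set" where
  "\<phi> \<in> LDelta0P \<Longrightarrow> \<phi> \<in> LSigma1P"
| "\<phi> \<in> LSigma1P \<Longrightarrow> LEx x \<phi> \<in> LSigma1P"

definition L_Separation :: "('m \<Rightarrow> 'm \<Rightarrow> bool) \<Rightarrow> lfm set \<Rightarrow> bool" where
  "L_Separation E = separation UNIV UNIV E (lsat E)"

definition L_Collection :: "('m \<Rightarrow> 'm \<Rightarrow> bool) \<Rightarrow> lfm set \<Rightarrow> bool" where
  "L_Collection E = collection UNIV UNIV E (lsat E)"

definition L_Foundation :: "('m \<Rightarrow> 'm \<Rightarrow> bool) \<Rightarrow> lfm set \<Rightarrow> bool" where
  "L_Foundation E = foundation UNIV E (lsat E)"

definition KP :: "('m \<Rightarrow> 'm \<Rightarrow> bool) \<Rightarrow> bool" where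
  "KP E \<longleftrightarrow>
     (\<forall>x y. (\<forall>z. E z x \<longleftrightarrow> E z y) \<longrightarrow> x = y) \<and>
     (\<forall>x y. \<exists>w. \<forall>z. E z w \<longleftrightarrow> z = x \<or> z = y) \<and>
     (\<forall>x. \<exists>u. \<forall>z. E z u \<longleftrightarrow> (\<exists>y. E y x \<and> E z y)) \<and>
     L_Separation E LDelta0 \<and> L_Collection E LDelta0 \<and> L_Foundation E LPi1"

definition Powerset :: "('m \<Rightarrow> 'm \<Rightarrow> bool) \<Rightarrow> bool" where
  "Powerset E \<longleftrightarrow> (\<forall>x. \<exists>w. \<forall>z. E z w \<longleftrightarrow> (\<forall>v. E v z \<longrightarrow> E v x))"


section \<open>The languages with urelements\<close>

text \<open>
  The function symbols of \<open>\<L>\<^sup>*\<close> are those of type \<open>fsym\<close>, the function symbols of \<open>\<L>\<^sup>*\<^sub>P\<close> those of type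
  \<open>fsymP\<close>.  Terms, formulae and structures are generic in the type \<open>'f\<close> of function symbols.
\<close>

datatype fsym = F_sym
datatype fsymP = Base fsym | P_sym

datatype 'f trm = Var nat | App 'f "'f trm"

primrec vars :: "'f trm \<Rightarrow> nat set" where
  "vars (Var x) = {x}"
| "vars (App f t) = vars t"

datatype 'f fm =
  Mem "'f trm" "'f trm" | Eq "'f trm" "'f trm" | ERel "'f trm" "'f trm" | IsUr "'f trm"
| Neg "'f fm" | And "'f fm" "'f fm" | Exi nat "'f fm"

abbreviation Uni :: "nat \<Rightarrow> 'f fm \<Rightarrow> 'f fm" where
  "Uni x \<phi> \<equiv> Neg (Exi x (Neg \<phi>))"

inductive_set Delta0 :: "'f fm set" where
  "Mem t u \<in> Delta0"
| "Eq t u \<in> Delta0"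
| "ERel t u \<in> Delta0"
| "IsUr t \<in> Delta0"
| "\<phi> \<in> Delta0 \<Longrightarrow> Neg \<phi> \<in> Delta0"
| "\<phi> \<in> Delta0 \<Longrightarrow> \<psi> \<in> Delta0 \<Longrightarrow> And \<phi> \<psi> \<in> Delta0"
| "x \<notin> vars t \<Longrightarrow> \<phi> \<in> Delta0 \<Longrightarrow> Exi x (And (Mem (Var x) t) \<phi>) \<in> Delta0"

inductive_set Pi1 :: "'f fm set" where
  "\<phi> \<in> Delta0 \<Longrightarrow> \<phi> \<in> Pi1"
| "\<phi> \<in> Pi1 \<Longrightarrow> Uni x \<phi> \<in> Pi1"

record ('f, 'u) astruct =
  dmn :: "'u set"
  urs :: "'u set"
  erel :: "'u \<Rightarrow> 'u \<Rightarrow> bool"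
  mem :: "'u \<Rightarrow> 'u \<Rightarrow> bool"
  fn :: "'f \<Rightarrow> 'u \<Rightarrow> 'u"

definition asets :: "('f, 'u) astruct \<Rightarrow> 'u set" where
  "asets \<AA> = dmn \<AA> - urs \<AA>"

definition is_structure :: "('f, 'u) astruct \<Rightarrow> bool" where
  "is_structure \<AA> \<longleftrightarrow>
     dmn \<AA> \<noteq> {} \<and> urs \<AA> \<subseteq> dmn \<AA> \<and>
     (\<forall>x y. erel \<AA> x y \<longrightarrow> x \<in> urs \<AA> \<and> y \<in> urs \<AA>) \<and>
     (\<forall>x y. mem \<AA> x y \<longrightarrow> x \<in> dmn \<AA> \<and> y \<in> asets \<AA>) \<and>
     (\<forall>f. \<forall>x\<in>dmn \<AA>. fn \<AA> f x \<in> dmn \<AA>)"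

primrec val :: "('f, 'u) astruct \<Rightarrow> (nat \<Rightarrow> 'u) \<Rightarrow> 'f trm \<Rightarrow> 'u" where
  "val \<AA> s (Var x) = s x"
| "val \<AA> s (App f t) = fn \<AA> f (val \<AA> s t)"

primrec sat :: "('f, 'u) astruct \<Rightarrow> 'f fm \<Rightarrow> (nat \<Rightarrow> 'u) \<Rightarrow> bool" where
  "sat \<AA> (Mem t u) s \<longleftrightarrow> mem \<AA> (val \<AA> s t) (val \<AA> s u)"
| "sat \<AA> (Eq t u) s \<longleftrightarrow> val \<AA> s t = val \<AA> s u"
| "sat \<AA> (ERel t u) s \<longleftrightarrow> erel \<AA> (val \<AA> s t) (val \<AA> s u)"
| "sat \<AA> (IsUr t) s \<longleftrightarrow> val \<AA> s t \<in> urs \<AA>"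
| "sat \<AA> (Neg \<phi>) s \<longleftrightarrow> \<not> sat \<AA> \<phi> s"
| "sat \<AA> (And \<phi> \<psi>) s \<longleftrightarrow> sat \<AA> \<phi> s \<and> sat \<AA> \<psi> s"
| "sat \<AA> (Exi x \<phi>) s \<longleftrightarrow> (\<exists>v\<in>dmn \<AA>. sat \<AA> \<phi> (s(x := v)))"

definition Schemes :: "('f, 'u) astruct \<Rightarrow> bool" where
  "Schemes \<AA> \<longleftrightarrow>
     separation (dmn \<AA>) (asets \<AA>) (mem \<AA>) (sat \<AA>) Delta0 \<and>
     collection (dmn \<AA>) (asets \<AA>) (mem \<AA>) (sat \<AA>) Delta0 \<and>
     foundation (dmn \<AA>) (mem \<AA>) (sat \<AA>) Pi1"

definition KPU_Cov :: "(fsym, 'u) astruct \<Rightarrow> bool" where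
  "KPU_Cov \<AA> \<longleftrightarrow>
     asets \<AA> \<noteq> {} \<and>
     (\<forall>p\<in>urs \<AA>. \<forall>x\<in>dmn \<AA>. \<not> mem \<AA> x p) \<and>
     (\<forall>a\<in>asets \<AA>. \<forall>b\<in>asets \<AA>. (\<forall>x\<in>dmn \<AA>. mem \<AA> x a \<longleftrightarrow> mem \<AA> x b) \<longrightarrow> a = b) \<and>
     (\<forall>x\<in>dmn \<AA>. \<forall>y\<in>dmn \<AA>. \<exists>a\<in>asets \<AA>. \<forall>z\<in>dmn \<AA>. mem \<AA> z a \<longleftrightarrow> z = x \<or> z = y) \<and>
     (\<forall>a\<in>asets \<AA>. \<exists>b\<in>asets \<AA>. \<forall>y\<in>dmn \<AA>. mem \<AA> y a \<longrightarrow>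
        (\<forall>x\<in>dmn \<AA>. mem \<AA> x y \<longrightarrow> mem \<AA> x b)) \<and>
     Schemes \<AA> \<and>
     (\<forall>p\<in>urs \<AA>. \<forall>x\<in>dmn \<AA>. erel \<AA> x p \<longleftrightarrow> mem \<AA> x (fn \<AA> F_sym p)) \<and>
     (\<forall>a\<in>asets \<AA>. fn \<AA> F_sym a \<in> asets \<AA> \<and> (\<forall>x\<in>dmn \<AA>. \<not> mem \<AA> x (fn \<AA> F_sym a)))"

definition reduct :: "(fsymP, 'u) astruct \<Rightarrow> (fsym, 'u) astruct" where
  "reduct \<BB> = \<lparr>dmn = dmn \<BB>, urs = urs \<BB>, erel = erel \<BB>, mem = mem \<BB>,
               fn = (\<lambda>f. fn \<BB> (Base f))\<rparr>"

definition expand :: "(fsym, 'u) astruct \<Rightarrow> ('u \<Rightarrow> 'u) \<Rightarrow> (fsymP, 'u) astruct" where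
  "expand \<AA> P = \<lparr>dmn = dmn \<AA>, urs = urs \<AA>, erel = erel \<AA>, mem = mem \<AA>,
                 fn = case_fsymP (fn \<AA>) P\<rparr>"

lemma reduct_expand [simp]: "reduct (expand \<AA> P) = \<AA>"
  by (simp add: reduct_def expand_def)

definition KPUP_Cov :: "(fsymP, 'u) astruct \<Rightarrow> bool" where
  "KPUP_Cov \<BB> \<longleftrightarrow>
     KPU_Cov (reduct \<BB>) \<and>
     (\<forall>a\<in>asets \<BB>. \<forall>b\<in>asets \<BB>.
        mem \<BB> b (fn \<BB> P_sym a) \<longleftrightarrow> (\<forall>x\<in>dmn \<BB>. mem \<BB> x b \<longrightarrow> mem \<BB> x a)) \<and>
     Schemes \<BB>"

definition admissible :: "(fsym, 'u) astruct \<Rightarrow> bool" where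
  "admissible \<AA> \<longleftrightarrow> is_structure \<AA> \<and> KPU_Cov \<AA> \<and> wf {(x, y). mem \<AA> x y}"

definition power_admissible :: "(fsymP, 'u) astruct \<Rightarrow> bool" where
  "power_admissible \<BB> \<longleftrightarrow> is_structure \<BB> \<and> KPUP_Cov \<BB> \<and> wf {(x, y). mem \<BB> x y}"


section \<open>Admissible covers\<close>

text \<open>
  A structure over \<open>\<M> = ('m, E)\<close> whose membership relation is that of the metatheory: the urelements
  are those of the universe, related as in \<open>\<M>\<close>, and the domain is transitive, so that the membership
  relation of the structure determines its sets as elements of the universe.
\<close>

definition standard_over ::
  "('m \<Rightarrow> 'm \<Rightarrow> bool) \<Rightarrow> ('f, ('m, 'k) V) astruct \<Rightarrow> bool" where
  "standard_over E \<AA> \<longleftrightarrow>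
     urs \<AA> = range Ur \<and> range Ur \<subseteq> dmn \<AA> \<and>
     (\<forall>y\<in>dmn \<AA>. \<forall>x. vmem x y \<longrightarrow> x \<in> dmn \<AA>) \<and>
     erel \<AA> = (\<lambda>x y. \<exists>p q. x = Ur p \<and> y = Ur q \<and> E p q) \<and>
     mem \<AA> = (\<lambda>x y. x \<in> dmn \<AA> \<and> y \<in> dmn \<AA> \<and> vmem x y)"

text \<open>
  \<open>F_of E\<close> sends an urelement to the set of its \<open>E\<close>-predecessors and everything else to the empty
  set.  The axioms of \<open>KPU_Cov\<close> force this on the domain of a standard structure, except that they
  do not say that the value at an urelement without predecessors is a set.
\<close>

definition F_of :: "('m \<Rightarrow> 'm \<Rightarrow> bool) \<Rightarrow> ('m, 'k) V \<Rightarrow> ('m, 'k) V" where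
  "F_of E y = (THE a. a \<notin> range Ur \<and>
     (\<forall>x. vmem x a \<longleftrightarrow> (\<exists>p q. x = Ur p \<and> y = Ur q \<and> E p q)))"

lemma F_of: "F_of E y \<notin> range Ur"
  "vmem x (F_of E y) \<longleftrightarrow> (\<exists>p q. x = Ur p \<and> y = Ur q \<and> E p q)"
  for E :: "'m \<Rightarrow> 'm \<Rightarrow> bool" and x y :: "('m, 'k) V"
proof -
  define R where "R x \<longleftrightarrow> (\<exists>p q. x = Ur p \<and> y = Ur q \<and> E p q)" for x :: "('m, 'k) V"
  define h :: "'m + nat + 'k \<Rightarrow> ('m, 'k) V" where "h = case_sum Ur undefined"
  let ?I = "Inl ` {p. R (Ur p)}"
  obtain a :: "('m, 'k) V" where a: "a \<notin> range Ur" "\<forall>x. vmem x a \<longleftrightarrow> x \<in> h ` ?I"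
    using V_comprehension[of h ?I] by (elim exE conjE)
  have "h ` ?I = Collect R"
    by (auto simp: h_def R_def image_image)
  with a have R: "\<forall>x. vmem x a \<longleftrightarrow> R x" by simp
  have "F_of E y = a"
    unfolding F_of_def R_def[symmetric]
  proof (rule the_equality)
    fix b :: "('m, 'k) V"
    assume "b \<notin> range Ur \<and> (\<forall>x. vmem x b \<longleftrightarrow> R x)"
    then show "b = a" using a(1) R by (intro V_extensionality) simp_all
  qed (use a(1) R in simp)
  then show "F_of E y \<notin> range Ur"
    "vmem x (F_of E y) \<longleftrightarrow> (\<exists>p q. x = Ur p \<and> y = Ur q \<and> E p q)"
    using a(1) R by (simp_all add: R_def)
qed

definition is_Cov ::
  "('m \<Rightarrow> 'm \<Rightarrow> bool) \<Rightarrow> (fsym, ('m, 'k) V) astruct \<Rightarrow> bool" where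
  "is_Cov E \<AA> \<longleftrightarrow>
     standard_over E \<AA> \<and> admissible \<AA> \<and> fn \<AA> F_sym = F_of E \<and>
     (\<forall>\<AA>'. standard_over E \<AA>' \<and> admissible \<AA>' \<longrightarrow> asets \<AA> \<subseteq> asets \<AA>')"

definition is_CovP ::
  "('m \<Rightarrow> 'm \<Rightarrow> bool) \<Rightarrow> (fsymP, ('m, 'k) V) astruct \<Rightarrow> bool" where
  "is_CovP E \<BB> \<longleftrightarrow>
     standard_over E \<BB> \<and> power_admissible \<BB> \<and> fn \<BB> (Base F_sym) = F_of E \<and>
     (\<forall>\<BB>'. standard_over E \<BB>' \<and> power_admissible \<BB>' \<longrightarrow> asets \<BB> \<subseteq> asets \<BB>')"

lemma is_Cov_unique:
  assumes "is_Cov E \<AA>" "is_Cov E \<AA>'"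
  shows "\<AA> = \<AA>'"
proof -
  note std = assms[unfolded is_Cov_def standard_over_def]
  have "asets \<AA> = asets \<AA>'" using assms unfolding is_Cov_def by (intro equalityI) simp_all
  moreover have "dmn \<AA> = range Ur \<union> asets \<AA>" "dmn \<AA>' = range Ur \<union> asets \<AA>'"
    using std by (auto simp: asets_def)
  ultimately have "dmn \<AA> = dmn \<AA>'" by simp
  moreover have "fn \<AA> f = fn \<AA>' f" for f
    using std by (cases f) simp
  then have "fn \<AA> = fn \<AA>'" by (rule ext)
  ultimately show ?thesis
    using std by (intro astruct.equality) simp_all
qed

end

theory Submission imports Defs begin

text \<open>
  The sets of the cover are coded by elements of \<open>\<M>\<close>, and the cover consists of the well-founded
  codes.  A bounded formula about codes, with \<open>F\<close> and the power set operation allowed as terms, is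
  \<open>\<Delta>\<^sub>1\<^sup>\<P>\<close> over \<open>\<M>\<close>, which gives Separation.  For Collection, a bound in \<open>\<M>\<close>
  may contain ill-founded codes; but the ranks that suffice for a bound form a \<open>\<Sigma>\<^sub>1\<^sup>\<P>\<close> class that contains all
  ill-founded ones, so by Foundation it has a well-founded member.  Foundation in the cover is clear.
  Conversely, an admissible set covering \<open>\<M>\<close> can decode every well-founded code \<open>z\<close> by recursion along
  the sets \<open>F z\<close>, hence contains the cover.
\<close>


section \<open>Definability by bounded formulae\<close>

text \<open>The obstacle is that \<M> may be ill-founded, so that being a well-founded code need not
  be definable over \<M>. Two observations keep the work inside \<M>. Elements of well-founded codes
  are well-founded codes, so a bounded formula at such arguments has the same truth value in the
  definable structure of all codes. And a set code included in a well-founded one is well-founded,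
  so the power set formed by \<M> is right for the cover, although it need not be the full power set
  of the metatheory. Formulae become more than bounded only through terms: their values are named by
  existential quantifiers, and the graph of the power set operation takes quantifiers bounded by
  inclusion. Collection alone asks for an object whose well-foundedness is not inherited from the
  parameters. Descent from an ill-founded rank can stay ill-founded forever, so such a rank
  dominates every well-founded code. In the converse direction the difficulty is that an admissible
  set covering \<M> sees \<open>E\<close> only through \<open>F\<close>, so decoding has to be
  expressed by quantifiers bounded by values of \<open>F\<close> and by elements of a set that holds
  the decoding.\<close>

lemma lsat_finite_support:
  "\<exists>N. \<forall>s s'. (\<forall>i<N. s i = s' i) \<longrightarrow> lsat E \<phi> s = lsat E \<phi> s'"
proof (induction \<phi>)
  case (LMem x y)
  show ?case by (intro exI[of _ "Suc (max x y)"]) simp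
next
  case (LEq x y)
  show ?case by (intro exI[of _ "Suc (max x y)"]) simp
next
  case (LNeg \<phi>)
  then show ?case by simp
next
  case (LAnd \<phi> \<psi>)
  then obtain N N' where
    "\<forall>s s'. (\<forall>i<N. s i = s' i) \<longrightarrow> lsat E \<phi> s = lsat E \<phi> s'"
    "\<forall>s s'. (\<forall>i<N'. s i = s' i) \<longrightarrow> lsat E \<psi> s = lsat E \<psi> s'" by blast
  then have "lsat E (LAnd \<phi> \<psi>) s = lsat E (LAnd \<phi> \<psi>) s'" if "\<forall>i<max N N'. s i = s' i" for s s'
    using that by (metis lsat.simps(4) less_max_iff_disj)
  then show ?case by blast
next
  case (LEx x \<phi>)
  then obtain N where N: "\<forall>s s'. (\<forall>i<N. s i = s' i) \<longrightarrow> lsat E \<phi> s = lsat E \<phi> s'" by blast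
  have "lsat E (LEx x \<phi>) s = lsat E (LEx x \<phi>) s'" if "\<forall>i<N. s i = s' i" for s s'
  proof -
    have "lsat E \<phi> (s(x := v)) = lsat E \<phi> (s'(x := v))" for v
      using N[rule_format, of "s(x := v)" "s'(x := v)"] that by simp
    then show ?thesis by simp
  qed
  then show ?case by blast
qed

text \<open>One family with a flag covers \<open>LDelta0\<close> and \<open>LDelta0P\<close>, so
  that renaming and the calculus of definability are developed once for both.\<close>

inductive_set Bounded :: "bool \<Rightarrow> lfm set" for pw where
  "LMem x y \<in> Bounded pw"
| "LEq x y \<in> Bounded pw"
| "\<phi> \<in> Bounded pw \<Longrightarrow> LNeg \<phi> \<in> Bounded pw"
| "\<phi> \<in> Bounded pw \<Longrightarrow> \<psi> \<in> Bounded pw \<Longrightarrow> LAnd \<phi> \<psi> \<in> Bounded pw"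
| "x \<noteq> y \<Longrightarrow> \<phi> \<in> Bounded pw \<Longrightarrow> LEx x (LAnd (LMem x y) \<phi>) \<in> Bounded pw"
| "pw \<Longrightarrow> x \<noteq> y \<Longrightarrow> \<phi> \<in> Bounded pw \<Longrightarrow> LEx x (LAnd (LSub x y) \<phi>) \<in> Bounded pw"

lemma Bounded_False: "Bounded False = LDelta0"
proof
  show "Bounded False \<subseteq> LDelta0"
  proof
    show "\<phi> \<in> LDelta0" if "\<phi> \<in> Bounded False" for \<phi>
      using that by induction (auto intro: LDelta0.intros)
  qed
  show "LDelta0 \<subseteq> Bounded False"
  proof
    show "\<phi> \<in> Bounded False" if "\<phi> \<in> LDelta0" for \<phi>
      using that by induction (auto intro: Bounded.intros)
  qed
qed

lemma Bounded_True: "Bounded True = LDelta0P"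
proof
  show "Bounded True \<subseteq> LDelta0P"
  proof
    show "\<phi> \<in> LDelta0P" if "\<phi> \<in> Bounded True" for \<phi>
      using that by induction (auto intro: LDelta0P.intros)
  qed
  show "LDelta0P \<subseteq> Bounded True"
  proof
    show "\<phi> \<in> Bounded True" if "\<phi> \<in> LDelta0P" for \<phi>
      using that by induction (auto intro: Bounded.intros)
  qed
qed

text \<open>Renaming is stated through satisfaction, and \<rho> may identify variables; only bound
  variables need care. This is what later allows two formulae with unrelated assignments to be
  merged.\<close>

lemma Bounded_rename:
  assumes "\<phi> \<in> Bounded pw"
  shows "\<exists>\<phi>'\<in>Bounded pw. \<forall>s. lsat E \<phi>' s \<longleftrightarrow> lsat E \<phi> (\<lambda>i. s (\<rho> i))"
  using assms
proof (induction arbitrary: \<rho>)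
  case (1 x y)
  show ?case by (intro bexI[of _ "LMem (\<rho> x) (\<rho> y)"]) (auto intro: Bounded.intros)
next
  case (2 x y)
  show ?case by (intro bexI[of _ "LEq (\<rho> x) (\<rho> y)"]) (auto intro: Bounded.intros)
next
  case (3 \<phi>)
  then obtain \<phi>' where "\<phi>' \<in> Bounded pw" "\<forall>s. lsat E \<phi>' s \<longleftrightarrow> lsat E \<phi> (\<lambda>i. s (\<rho> i))" by blast
  then show ?case by (intro bexI[of _ "LNeg \<phi>'"]) (auto intro: Bounded.intros)
next
  case (4 \<phi> \<psi>)
  obtain \<phi>' where "\<phi>' \<in> Bounded pw" "\<forall>s. lsat E \<phi>' s \<longleftrightarrow> lsat E \<phi> (\<lambda>i. s (\<rho> i))"
    using 4 by blast
  moreover obtain \<psi>' where "\<psi>' \<in> Bounded pw" "\<forall>s. lsat E \<psi>' s \<longleftrightarrow> lsat E \<psi> (\<lambda>i. s (\<rho> i))"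
    using 4 by blast
  ultimately show ?case by (intro bexI[of _ "LAnd \<phi>' \<psi>'"]) (auto intro: Bounded.intros)
next
  case (5 x y \<phi>)
  obtain N where N: "\<forall>s s'. (\<forall>i<N. s i = s' i) \<longrightarrow> lsat E \<phi> s = lsat E \<phi> s'"
    using lsat_finite_support by blast
  \<comment> \<open>A fresh bound variable: it exceeds the images of all variables on which \<phi>
    depends and of the bounding variable, so nothing is captured.\<close>
  define n where "n = Suc (Max (insert (\<rho> y) (\<rho> ` {..<N})))"
  have n: "\<rho> y < n" "\<And>i. i < N \<Longrightarrow> \<rho> i < n"
    unfolding n_def by (auto intro!: Max_ge simp: less_Suc_eq_le)
  obtain \<phi>' where \<phi>': "\<phi>' \<in> Bounded pw"
    "\<forall>s. lsat E \<phi>' s \<longleftrightarrow> lsat E \<phi> (\<lambda>i. s ((\<rho>(x := n)) i))" using 5 by blast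
  have eq: "lsat E \<phi>' (s(n := v)) = lsat E \<phi> ((\<lambda>i. s (\<rho> i))(x := v))" for s v
    unfolding \<phi>'(2)[rule_format] by (rule N[rule_format]) (auto dest: n(2))
  show ?case
    using n(1) \<phi>'(1) 5(1) by (intro bexI[of _ "LEx n (LAnd (LMem n (\<rho> y)) \<phi>')"])
      (auto intro!: Bounded.intros simp: eq)
next
  case (6 x y \<phi>)
  obtain N where N: "\<forall>s s'. (\<forall>i<N. s i = s' i) \<longrightarrow> lsat E \<phi> s = lsat E \<phi> s'"
    using lsat_finite_support by blast
  define n where "n = Suc (Max (insert (\<rho> y) (\<rho> ` {..<N})))"
  have n: "\<rho> y < n" "\<And>i. i < N \<Longrightarrow> \<rho> i < n"
    unfolding n_def by (auto intro!: Max_ge simp: less_Suc_eq_le)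
  obtain \<phi>' where \<phi>': "\<phi>' \<in> Bounded pw"
    "\<forall>s. lsat E \<phi>' s \<longleftrightarrow> lsat E \<phi> (\<lambda>i. s ((\<rho>(x := n)) i))" using 6 by blast
  have eq: "lsat E \<phi>' (s(n := v)) = lsat E \<phi> ((\<lambda>i. s (\<rho> i))(x := v))" for s v
    unfolding \<phi>'(2)[rule_format] by (rule N[rule_format]) (auto dest: n(2))
  show ?case
    using n(1) \<phi>'(1) 6(1,2) by (intro bexI[of _ "LEx n (LAnd (LSub n (\<rho> y)) \<phi>')"])
      (auto intro!: Bounded.intros simp: eq)
qed

text \<open>
  Definability without variable names: a relation \<open>R\<close> on contexts of an arbitrary type \<open>'c\<close> is definable
  if it is expressed by a bounded formula whose variables are interpreted by functions in \<open>V\<close>.  A bounded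
  quantifier passes from \<open>'c\<close> to \<open>'c \<times> 'm\<close> and from \<open>V\<close> to \<open>ext V\<close>; constant functions in \<open>V\<close> are
  parameters.  The flag \<open>pw\<close> tells whether quantifiers bounded by inclusion are allowed.
\<close>

definition ext :: "('c \<Rightarrow> 'm) set \<Rightarrow> ('c \<times> 'm \<Rightarrow> 'm) set" where
  "ext V = insert snd ((\<lambda>f p. f (fst p)) ` V)"

lemma ext_snd: "(\<lambda>p. snd p) \<in> ext V"
  by (simp add: ext_def)

lemma ext_fst: "f \<in> V \<Longrightarrow> (\<lambda>p. f (fst p)) \<in> ext V"
  by (auto simp: ext_def)

locale relation = fixes E :: "'m \<Rightarrow> 'm \<Rightarrow> bool"
begin

definition dfn :: "bool \<Rightarrow> ('c \<Rightarrow> 'm) set \<Rightarrow> ('c \<Rightarrow> bool) \<Rightarrow> bool" where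
  "dfn pw V R \<longleftrightarrow> (\<exists>\<phi>\<in>Bounded pw. \<exists>e. range e \<subseteq> V \<and> (\<forall>c. R c \<longleftrightarrow> lsat E \<phi> (\<lambda>i. e i c)))"

lemma dfn_mem:
  assumes "f \<in> V" "g \<in> V" shows "dfn pw V (\<lambda>c. E (f c) (g c))"
  unfolding dfn_def using assms
  by (intro bexI[of _ "LMem 0 1"] exI[of _ "case_nat f (\<lambda>_. g)"])
    (auto intro: Bounded.intros split: nat.splits)

lemma dfn_eq:
  assumes "f \<in> V" "g \<in> V" shows "dfn pw V (\<lambda>c. f c = g c)"
  unfolding dfn_def using assms
  by (intro bexI[of _ "LEq 0 1"] exI[of _ "case_nat f (\<lambda>_. g)"])
    (auto intro: Bounded.intros split: nat.splits)

lemma dfn_not: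
  assumes "dfn pw V R" shows "dfn pw V (\<lambda>c. \<not> R c)"
proof -
  from assms obtain \<phi> e where "\<phi> \<in> Bounded pw" "range e \<subseteq> V" "\<forall>c. R c \<longleftrightarrow> lsat E \<phi> (\<lambda>i. e i c)"
    unfolding dfn_def by blast
  then show ?thesis unfolding dfn_def
    by (intro bexI[of _ "LNeg \<phi>"] exI[of _ e]) (auto intro: Bounded.intros)
qed

lemma dfn_conj:
  assumes "dfn pw V R" "dfn pw V S" shows "dfn pw V (\<lambda>c. R c \<and> S c)"
proof -
  from assms(1) obtain \<phi> e where
    \<phi>: "\<phi> \<in> Bounded pw" "range e \<subseteq> V" "\<forall>c. R c \<longleftrightarrow> lsat E \<phi> (\<lambda>i. e i c)"
    unfolding dfn_def by blast
  from assms(2) obtain \<psi> d where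
    \<psi>: "\<psi> \<in> Bounded pw" "range d \<subseteq> V" "\<forall>c. S c \<longleftrightarrow> lsat E \<psi> (\<lambda>i. d i c)"
    unfolding dfn_def by blast
  obtain \<phi>' where \<phi>': "\<phi>' \<in> Bounded pw" "\<forall>s. lsat E \<phi>' s \<longleftrightarrow> lsat E \<phi> (\<lambda>i. s (2 * i))"
    using Bounded_rename[OF \<phi>(1), of E "\<lambda>i. 2 * i"] by blast
  obtain \<psi>' where \<psi>': "\<psi>' \<in> Bounded pw" "\<forall>s. lsat E \<psi>' s \<longleftrightarrow> lsat E \<psi> (\<lambda>i. s (Suc (2 * i)))"
    using Bounded_rename[OF \<psi>(1), of E "\<lambda>i. Suc (2 * i)"] by blast
  \<comment> \<open>The two assignments are interleaved: even variables belong to the first formula,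
    odd ones to the second.\<close>
  let ?h = "\<lambda>i. if even i then e (i div 2) else d (i div 2)"
  have "\<forall>c. (R c \<and> S c) \<longleftrightarrow> lsat E (LAnd \<phi>' \<psi>') (\<lambda>i. ?h i c)"
    unfolding lsat.simps \<phi>'(2)[rule_format] \<psi>'(2)[rule_format] \<phi>(3)[rule_format] \<psi>(3)[rule_format]
    by simp
  moreover have "range ?h \<subseteq> V" using \<phi>(2) \<psi>(2) by (auto simp: image_subset_iff)
  moreover have "LAnd \<phi>' \<psi>' \<in> Bounded pw" using \<phi>'(1) \<psi>'(1) by (rule Bounded.intros)
  ultimately show ?thesis
    unfolding dfn_def by (intro bexI[of _ "LAnd \<phi>' \<psi>'"] exI[of _ ?h] conjI)
qed

lemma dfn_disj:
  assumes "dfn pw V R" "dfn pw V S" shows "dfn pw V (\<lambda>c. R c \<or> S c)"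
proof -
  have "dfn pw V (\<lambda>c. \<not> (\<not> R c \<and> \<not> S c))" using assms by (intro dfn_not dfn_conj)
  then show ?thesis by simp
qed

lemma dfn_imp:
  assumes "dfn pw V R" "dfn pw V S" shows "dfn pw V (\<lambda>c. R c \<longrightarrow> S c)"
  unfolding imp_conv_disj using assms by (intro dfn_disj dfn_not)

lemma dfn_iff:
  assumes "dfn pw V R" "dfn pw V S" shows "dfn pw V (\<lambda>c. R c \<longleftrightarrow> S c)"
  unfolding iff_conv_conj_imp using assms by (intro dfn_conj dfn_imp)

text \<open>Normal form for the body of a bounded quantifier: variable 0 is the quantified element,
  variable 1 the bound \<open>f\<close>, and every other variable is shifted by 2. All variables
  interpreted by \<open>snd\<close> are identified with 0.\<close>

lemma dfn_quantifier:
  assumes f: "f \<in> V" and R: "dfn pw (ext V) (\<lambda>p. R (fst p) (snd p))"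
  obtains \<phi> e where "\<phi> \<in> Bounded pw" "range e \<subseteq> V" "e 1 = f"
    "\<And>c v. R c v \<longleftrightarrow> lsat E \<phi> ((\<lambda>i. e i c)(0 := v))"
proof -
  from R obtain \<phi> e where
    \<phi>: "\<phi> \<in> Bounded pw" "range e \<subseteq> ext V" "\<forall>c v. R c v \<longleftrightarrow> lsat E \<phi> (\<lambda>i. e i (c, v))"
    unfolding dfn_def by fastforce
  let ?\<rho> = "\<lambda>i. if e i = snd then 0 else i + 2"
  obtain \<phi>' where \<phi>': "\<phi>' \<in> Bounded pw" "\<forall>s. lsat E \<phi>' s \<longleftrightarrow> lsat E \<phi> (\<lambda>i. s (?\<rho> i))"
    using Bounded_rename[OF \<phi>(1), of E ?\<rho>] by blast
  have "\<forall>i. \<exists>g\<in>V. e i \<noteq> snd \<longrightarrow> e i = (\<lambda>p. g (fst p))"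
    using \<phi>(2) f unfolding ext_def by blast
  then obtain g where g: "\<And>i. g i \<in> V" "\<And>i. e i \<noteq> snd \<Longrightarrow> e i = (\<lambda>p. g i (fst p))" by metis
  show thesis
  proof (rule that[of \<phi>' "\<lambda>i. if i < 2 then f else g (i - 2)"])
    fix c v
    have "(\<lambda>i. e i (c, v)) = (\<lambda>i. ((\<lambda>i. (if i < 2 then f else g (i - 2)) c)(0 := v)) (?\<rho> i))"
      using g(2) by (auto simp: fun_eq_iff)
    then show "R c v \<longleftrightarrow> lsat E \<phi>' ((\<lambda>i. (if i < 2 then f else g (i - 2)) c)(0 := v))"
      using \<phi>(3) \<phi>'(2) by simp
  qed (use \<phi>' f g in auto)
qed

lemma dfn_bex:
  assumes f: "f \<in> V" and R: "dfn pw (ext V) (\<lambda>p. R (fst p) (snd p))"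
  shows "dfn pw V (\<lambda>c. \<exists>v. E v (f c) \<and> R c v)"
proof -
  obtain \<phi> e where "\<phi> \<in> Bounded pw" "range e \<subseteq> V" "e 1 = f"
    "\<And>c v. R c v \<longleftrightarrow> lsat E \<phi> ((\<lambda>i. e i c)(0 := v))" using dfn_quantifier[OF assms] by metis
  then show ?thesis unfolding dfn_def
    by (intro bexI[of _ "LEx 0 (LAnd (LMem 0 1) \<phi>)"] exI[of _ e])
      (auto intro!: Bounded.intros)
qed

lemma dfn_bex_subset:
  assumes pw and f: "f \<in> V" and R: "dfn pw (ext V) (\<lambda>p. R (fst p) (snd p))"
  shows "dfn pw V (\<lambda>c. \<exists>v. (\<forall>z. E z v \<longrightarrow> E z (f c)) \<and> R c v)"
proof -
  obtain \<phi> e where "\<phi> \<in> Bounded pw" "range e \<subseteq> V" "e 1 = f"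
    "\<And>c v. R c v \<longleftrightarrow> lsat E \<phi> ((\<lambda>i. e i c)(0 := v))" using dfn_quantifier[OF f R] by metis
  then show ?thesis unfolding dfn_def using \<open>pw\<close>
    by (intro bexI[of _ "LEx 0 (LAnd (LSub 0 1) \<phi>)"] exI[of _ e])
      (auto intro!: Bounded.intros)
qed

lemma dfn_ball:
  assumes "f \<in> V" "dfn pw (ext V) (\<lambda>p. R (fst p) (snd p))"
  shows "dfn pw V (\<lambda>c. \<forall>v. E v (f c) \<longrightarrow> R c v)"
proof -
  have "dfn pw V (\<lambda>c. \<not> (\<exists>v. E v (f c) \<and> \<not> R c v))" using assms by (intro dfn_not dfn_bex)
  then show ?thesis by simp
qed

lemma dfn_ball_subset:
  assumes pw "f \<in> V" "dfn pw (ext V) (\<lambda>p. R (fst p) (snd p))"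
  shows "dfn pw V (\<lambda>c. \<forall>v. (\<forall>z. E z v \<longrightarrow> E z (f c)) \<longrightarrow> R c v)"
proof -
  have "dfn pw V (\<lambda>c. \<not> (\<exists>v. (\<forall>z. E z v \<longrightarrow> E z (f c)) \<and> \<not> R c v))"
    using assms by (intro dfn_not dfn_bex_subset)
  moreover have "(\<lambda>c. \<not> (\<exists>v. (\<forall>z. E z v \<longrightarrow> E z (f c)) \<and> \<not> R c v)) =
    (\<lambda>c. \<forall>v. (\<forall>z. E z v \<longrightarrow> E z (f c)) \<longrightarrow> R c v)" by blast
  ultimately show ?thesis by simp
qed

lemma dfn_subst:
  assumes R: "dfn pw V R" and g: "\<And>f. f \<in> V \<Longrightarrow> (\<lambda>d. f (g d)) \<in> V'"
  shows "dfn pw V' (\<lambda>d. R (g d))"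
proof -
  from R obtain \<phi> e where "\<phi> \<in> Bounded pw" "range e \<subseteq> V" "\<forall>c. R c \<longleftrightarrow> lsat E \<phi> (\<lambda>i. e i c)"
    unfolding dfn_def by blast
  then show ?thesis unfolding dfn_def using g
    by (intro bexI[of _ \<phi>] exI[of _ "\<lambda>i d. e i (g d)"]) auto
qed

lemma dfn_const:
  assumes "V \<noteq> {}" shows "dfn pw V (\<lambda>_. P)"
proof -
  from assms obtain f where "f \<in> V" by blast
  from dfn_eq[OF this this] dfn_not[OF dfn_eq[OF this this]] show ?thesis
    by (cases P) simp_all
qed

lemmas dfn_intros = dfn_mem dfn_eq dfn_not dfn_conj dfn_disj dfn_imp dfn_iff dfn_bex dfn_ball
  ext_fst ext_snd

text \<open>The way back from contexts to the named variables of the axiom schemes. Over the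
  one-point context a variable is interpreted by one of the two coordinates or by a constant; these
  become variable 0, variable 1 and the parameters.\<close>

lemma dfn_pair_normal:
  assumes "dfn pw (ext (ext (UNIV :: (unit \<Rightarrow> 'm) set))) (\<lambda>p. R (snd (fst p)) (snd p))"
  obtains \<phi> s where "\<phi> \<in> Bounded pw" "\<And>x y. R x y \<longleftrightarrow> lsat E \<phi> (s(0 := x, 1 := y))"
proof -
  from assms obtain \<phi> e where \<phi>: "\<phi> \<in> Bounded pw" "range e \<subseteq> ext (ext UNIV)"
    "\<And>x y. R x y \<longleftrightarrow> lsat E \<phi> (\<lambda>i. e i (((), x), y))"
    unfolding dfn_def by fastforce
  let ?\<rho> = "\<lambda>i. if e i = snd then 1 else if e i = (\<lambda>p. snd (fst p)) then 0 else i + 2"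
  obtain \<phi>' where \<phi>': "\<phi>' \<in> Bounded pw" "\<forall>s. lsat E \<phi>' s \<longleftrightarrow> lsat E \<phi> (\<lambda>i. s (?\<rho> i))"
    using Bounded_rename[OF \<phi>(1), of E ?\<rho>] by blast
  have "\<exists>k. \<forall>p. e i p = k" if "e i \<noteq> snd" "e i \<noteq> (\<lambda>p. snd (fst p))" for i
  proof -
    have "e i \<in> ext (ext UNIV)" using \<phi>(2) by blast
    then show ?thesis using that by (auto simp: ext_def)
  qed
  then obtain k where k: "\<And>i p. e i \<noteq> snd \<Longrightarrow> e i \<noteq> (\<lambda>p. snd (fst p)) \<Longrightarrow> e i p = k i" by metis
  show thesis
  proof (rule that[of \<phi>' "\<lambda>i. k (i - 2)"])
    fix x y
    have "e i (((), x), y) = ((\<lambda>i. k (i - 2))(0 := x, 1 := y)) (?\<rho> i)" for i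
      using k[of i] by simp
    then have "(\<lambda>i. e i (((), x), y)) = (\<lambda>i. ((\<lambda>i. k (i - 2))(0 := x, 1 := y)) (?\<rho> i))" ..
    then show "R x y \<longleftrightarrow> lsat E \<phi>' ((\<lambda>i. k (i - 2))(0 := x, 1 := y))"
      unfolding \<phi>(3) \<phi>'(2)[rule_format] by simp
  qed (rule \<phi>'(1))
qed

end

lemma ext_pair:
  assumes "f \<in> ext V" "\<And>h. h \<in> V \<Longrightarrow> (\<lambda>d. h (a d)) \<in> V'" "(\<lambda>d. b d) \<in> V'"
  shows "(\<lambda>d. f (a d, b d)) \<in> V'"
  using assms by (auto simp: ext_def)

text \<open>The case in which the context is itself an assignment; satisfaction of a formula then
  becomes a relation to which the calculus applies.\<close>

definition projections :: "((nat \<Rightarrow> 'm) \<Rightarrow> 'm) set" where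
  "projections = range (\<lambda>i s. s i) \<union> range (\<lambda>k s. k)"

abbreviation constants :: "(unit \<Rightarrow> 'm) set" where "constants \<equiv> UNIV"

lemma projections_intros: "(\<lambda>s. s i) \<in> projections" "(\<lambda>s. k) \<in> projections"
  by (auto simp: projections_def)

lemma projections_subst:
  assumes "f \<in> projections" "\<And>i. (\<lambda>d. a d i) \<in> V" "\<And>k. (\<lambda>d. k) \<in> V"
  shows "(\<lambda>d. f (a d)) \<in> V"
  using assms by (auto simp: projections_def)

context relation
begin

lemma dfn_subst_pair:
  assumes "dfn pw (ext V) (\<lambda>p. Q (fst p) (snd p))"
    and "\<And>h. h \<in> V \<Longrightarrow> (\<lambda>d. h (a d)) \<in> V'" "(\<lambda>d. b d) \<in> V'"
  shows "dfn pw V' (\<lambda>d. Q (a d) (b d))"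
  using dfn_subst[OF assms(1), of "\<lambda>d. (a d, b d)"] ext_pair[of _ V a V' b, OF _ assms(2,3)] by simp

lemma dfn_binary:
  assumes "dfn pw (ext (ext constants)) (\<lambda>p. R (snd (fst p)) (snd p))"
    and "\<And>k. (\<lambda>c. k) \<in> V" "a \<in> V" "b \<in> V"
  shows "dfn pw V (\<lambda>c. R (a c) (b c))"
proof -
  have "(\<lambda>d. f (((), a d), b d)) \<in> V" if "f \<in> ext (ext constants)" for f
    using that assms by (auto simp: ext_def)
  from dfn_subst[OF assms(1), of "\<lambda>d. (((), a d), b d)", OF this] show ?thesis by simp
qed

lemma dfn_unary:
  assumes "dfn pw (ext constants) (\<lambda>p. R (snd p))" "\<And>k. (\<lambda>c. k) \<in> V" "b \<in> V"
  shows "dfn pw V (\<lambda>c. R (b c))"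
proof -
  have "(\<lambda>d. f ((), b d)) \<in> V" if "f \<in> ext constants" for f
    using that assms by (auto simp: ext_def)
  from dfn_subst[OF assms(1), of "\<lambda>d. ((), b d)", OF this] show ?thesis by simp
qed

end

section \<open>\<open>\<Sigma>\<^sub>1\<^sup>\<P>\<close> relations\<close>

locale model = relation E for E :: "'m \<Rightarrow> 'm \<Rightarrow> bool" +
  assumes KP: "KP E" and Powerset: "Powerset E"
    and Collection: "L_Collection E LDelta0P" and Foundation: "L_Foundation E LSigma1P"
begin

lemma E_ext: "(\<And>z. E z x \<longleftrightarrow> E z y) \<Longrightarrow> x = y"
  using KP unfolding KP_def by blast

definition upair where "upair x y = (SOME w. \<forall>z. E z w \<longleftrightarrow> z = x \<or> z = y)"
definition bigun where "bigun x = (SOME u. \<forall>z. E z u \<longleftrightarrow> (\<exists>y. E y x \<and> E z y))"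
definition Pw where "Pw x = (SOME w. \<forall>z. E z w \<longleftrightarrow> (\<forall>v. E v z \<longrightarrow> E v x))"

lemma E_upair [simp]: "E z (upair x y) \<longleftrightarrow> z = x \<or> z = y"
proof -
  have "\<exists>w. \<forall>z. E z w \<longleftrightarrow> z = x \<or> z = y" using KP unfolding KP_def by blast
  from someI_ex[OF this] show ?thesis unfolding upair_def by blast
qed

lemma E_bigun [simp]: "E z (bigun x) \<longleftrightarrow> (\<exists>y. E y x \<and> E z y)"
proof -
  have "\<exists>u. \<forall>z. E z u \<longleftrightarrow> (\<exists>y. E y x \<and> E z y)" using KP unfolding KP_def by blast
  from someI_ex[OF this] show ?thesis unfolding bigun_def by blast
qed

lemma E_Pw [simp]: "E z (Pw x) \<longleftrightarrow> (\<forall>v. E v z \<longrightarrow> E v x)"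
proof -
  have "\<exists>w. \<forall>z. E z w \<longleftrightarrow> (\<forall>v. E v z \<longrightarrow> E v x)" using Powerset unfolding Powerset_def by blast
  from someI_ex[OF this] show ?thesis unfolding Pw_def by blast
qed

definition union where "union x y = bigun (upair x y)"

lemma E_union [simp]: "E z (union x y) \<longleftrightarrow> E z x \<or> E z y"
  unfolding union_def by auto

section \<open>Separation for formulae with quantifiers bounded by inclusion\<close>

lemma separation_dfn_False:
  assumes "dfn False (ext constants) (\<lambda>p. R (snd p))"
  shows "\<exists>b. \<forall>x. E x b \<longleftrightarrow> E x a \<and> R x"
proof -
  have "dfn False (ext (ext constants)) (\<lambda>p. R (snd (fst p)))"
    using dfn_subst[OF assms, of fst] by (auto intro: ext_fst)
  from dfn_pair_normal[OF this] obtain \<phi> s where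
    \<phi>: "\<phi> \<in> Bounded False" "\<And>x y. R x \<longleftrightarrow> lsat E \<phi> (s(0 := x, 1 := y))" by metis
  have "R x \<longleftrightarrow> lsat E \<phi> (s(0 := x))" for x
    using \<phi>(2)[of x "s 1"] by (simp add: fun_upd_idem)
  moreover have "L_Separation E LDelta0" using KP unfolding KP_def by blast
  then have "\<exists>b. \<forall>x. E x b \<longleftrightarrow> E x a \<and> lsat E \<phi> (s(0 := x))"
    using \<phi>(1) unfolding L_Separation_def separation_def Bounded_False by simp
  ultimately show ?thesis by simp
qed

text \<open>Encloses a set together with finitely many parameter values in a single set, as needed
  for eliminating quantifiers bounded by inclusion.\<close>

lemma finite_collect: "\<exists>A. \<forall>x. E x A \<longleftrightarrow> E x a \<or> (\<exists>i<n. x = s (i::nat))"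
proof (induction n)
  case 0
  show ?case by auto
next
  case (Suc n)
  then obtain A where "\<forall>x. E x A \<longleftrightarrow> E x a \<or> (\<exists>i<n. x = s i)" by blast
  then show ?case by (intro exI[of _ "union A (upair (s n) (s n))"]) (auto simp: less_Suc_eq)
qed

lemma dfn_update:
  assumes "dfn pw projections R"
  shows "dfn pw (ext projections) (\<lambda>p. R ((fst p)(x := snd p)))"
  using assms
proof (rule dfn_subst)
  fix f :: "(nat \<Rightarrow> 'm) \<Rightarrow> 'm"
  assume "f \<in> projections"
  then show "(\<lambda>d. f ((fst d)(x := snd d))) \<in> ext projections"
  proof (rule projections_subst)
    show "(\<lambda>d. ((fst d)(x := snd d)) i) \<in> ext projections" for i :: nat
      by (cases "i = x") (auto intro: ext_snd ext_fst projections_intros)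
    show "(\<lambda>d. k) \<in> ext projections" for k :: 'm
      by (rule ext_fst[OF projections_intros(2)])
  qed
qed

text \<open>On assignments into a fixed set, a quantifier bounded by inclusion is bounded by a power set.\<close>

lemma bounded_subset_elim:
  assumes "\<phi> \<in> Bounded True"
  shows "\<exists>R. dfn False projections R \<and> (\<forall>s. (\<forall>i. E (s i) A) \<longrightarrow> R s = lsat E \<phi> s)"
  using assms
proof (induction arbitrary: A)
  case (1 x y)
  show ?case
    by (intro exI[of _ "\<lambda>s. E (s x) (s y)"]) (auto intro: dfn_intros projections_intros)
next
  case (2 x y)
  show ?case
    by (intro exI[of _ "\<lambda>s. s x = s y"]) (auto intro: dfn_intros projections_intros)
next
  case (3 \<phi>)
  then obtain R where "dfn False projections R" "\<forall>s. (\<forall>i. E (s i) A) \<longrightarrow> R s = lsat E \<phi> s" by blast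
  then show ?case by (intro exI[of _ "\<lambda>s. \<not> R s"]) (auto intro: dfn_intros)
next
  case (4 \<phi> \<psi>)
  obtain R where R: "dfn False projections R" "\<forall>s. (\<forall>i. E (s i) A) \<longrightarrow> R s = lsat E \<phi> s"
    using 4 by blast
  obtain S where S: "dfn False projections S" "\<forall>s. (\<forall>i. E (s i) A) \<longrightarrow> S s = lsat E \<psi> s"
    using 4 by blast
  show ?case using R S by (intro exI[of _ "\<lambda>s. R s \<and> S s"]) (auto intro: dfn_intros)
next
  case (5 x y \<phi>)
  let ?A = "union A (bigun A)"
  obtain R where R: "dfn False projections R" "\<And>s. (\<forall>i. E (s i) ?A) \<Longrightarrow> R s = lsat E \<phi> s"
    using 5(3)[of ?A] by metis
  have "dfn False projections (\<lambda>s. \<exists>v. E v (s y) \<and> R (s(x := v)))"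
    by (intro dfn_bex projections_intros dfn_update R)
  moreover have "(\<exists>v. E v (s y) \<and> R (s(x := v))) = lsat E (LEx x (LAnd (LMem x y) \<phi>)) s"
    if "\<forall>i. E (s i) A" for s
  proof -
    have "R (s(x := v)) = lsat E \<phi> (s(x := v))" if "E v (s y)" for v
      using \<open>\<forall>i. E (s i) A\<close> that by (intro R) auto
    then show ?thesis using \<open>x \<noteq> y\<close> by auto
  qed
  ultimately show ?case by blast
next
  case (6 x y \<phi>)
  \<comment> \<open>A subset of an element of \<open>A\<close> is a subset of the union of
    \<open>A\<close>, so the enlarged set contains every value that the quantified variable can
    take.\<close>
  let ?A = "union A (Pw (bigun A))"
  obtain R where R: "dfn False projections R" "\<And>s. (\<forall>i. E (s i) ?A) \<Longrightarrow> R s = lsat E \<phi> s"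
    using 6(4)[of ?A] by metis
  have "dfn False projections (\<lambda>s. \<exists>v. E v ?A \<and> (\<forall>z. E z v \<longrightarrow> E z (s y)) \<and> R (s(x := v)))"
    by (intro dfn_intros projections_intros dfn_update R)
  moreover have "(\<exists>v. E v ?A \<and> (\<forall>z. E z v \<longrightarrow> E z (s y)) \<and> R (s(x := v))) =
      lsat E (LEx x (LAnd (LSub x y) \<phi>)) s"
    if "\<forall>i. E (s i) A" for s
  proof -
    have *: "E v ?A" if "\<forall>z. E z v \<longrightarrow> E z (s y)" for v
      using \<open>\<forall>i. E (s i) A\<close> that by auto
    have "R (s(x := v)) = lsat E \<phi> (s(x := v))" if "\<forall>z. E z v \<longrightarrow> E z (s y)" for v
      using \<open>\<forall>i. E (s i) A\<close> *[OF that] by (intro R) auto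
    with * have "(\<exists>v. E v ?A \<and> (\<forall>z. E z v \<longrightarrow> E z (s y)) \<and> R (s(x := v))) \<longleftrightarrow>
        (\<exists>v. (\<forall>z. E z v \<longrightarrow> E z (s y)) \<and> lsat E \<phi> (s(x := v)))" by blast
    then show ?thesis using \<open>x \<noteq> y\<close> by simp
  qed
  ultimately show ?case by blast
qed

text \<open>\<open>KP\<close> supplies Separation only for \<open>LDelta0\<close>. Here the
  separated element ranges over \<open>a\<close> and only finitely many parameters matter, so all
  relevant assignments live in one set, over which power sets serve as bounds for the quantifiers
  over subsets.\<close>

lemma separation_dfn:
  assumes "dfn True (ext constants) (\<lambda>p. R (snd p))"
  shows "\<exists>b. \<forall>x. E x b \<longleftrightarrow> E x a \<and> R x"
proof -
  have "dfn True (ext (ext constants)) (\<lambda>p. R (snd (fst p)))"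
    using dfn_subst[OF assms, of fst] by (auto intro: ext_fst)
  from dfn_pair_normal[OF this] obtain \<phi> s where
    \<phi>: "\<phi> \<in> Bounded True" "\<And>x y. R x \<longleftrightarrow> lsat E \<phi> (s(0 := x, 1 := y))" by metis
  have \<phi>2: "R x \<longleftrightarrow> lsat E \<phi> (s(0 := x))" for x
    using \<phi>(2)[of x "s 1"] by (simp add: fun_upd_idem)
  obtain N where N: "\<forall>s s'. (\<forall>i<N. s i = s' i) \<longrightarrow> lsat E \<phi> s = lsat E \<phi> s'"
    using lsat_finite_support by blast
  obtain A where A: "\<forall>x. E x A \<longleftrightarrow> E x a \<or> (\<exists>i<Suc N. x = s i)"
    using finite_collect by blast
  obtain R' where R': "dfn False projections R'" "\<And>s. (\<forall>i. E (s i) A) \<Longrightarrow> R' s = lsat E \<phi> s"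
    using bounded_subset_elim[OF \<phi>(1)] by metis
  \<comment> \<open>Variables beyond the support are reset to \<open>s 0\<close>, so that the whole
    assignment takes values in \<open>A\<close>. The bound \<open>Suc N\<close> in the choice of
    \<open>A\<close> puts \<open>s 0\<close> there even if \<open>N\<close> is 0.\<close>
  define s' where "s' i = (if i < N then s i else s 0)" for i
  have "R x \<longleftrightarrow> R' (s'(0 := x))" if "E x a" for x
  proof -
    have "R' (s'(0 := x)) = lsat E \<phi> (s'(0 := x))"
      using that A by (intro R') (auto simp: s'_def intro: less_SucI)
    also have "\<dots> = lsat E \<phi> (s(0 := x))" by (rule N[rule_format]) (simp add: s'_def)
    finally show ?thesis using \<phi>2 by simp
  qed
  moreover have "dfn False (ext constants) (\<lambda>p. R' (s'(0 := snd p)))"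
    using R'(1)
  proof (rule dfn_subst)
    fix f :: "(nat \<Rightarrow> 'm) \<Rightarrow> 'm"
    assume "f \<in> projections"
    then show "(\<lambda>p. f (s'(0 := snd p))) \<in> ext constants"
    proof (rule projections_subst)
      show "(\<lambda>p. (s'(0 := snd p)) i) \<in> ext constants" for i
        by (cases "i = 0") (auto intro: ext_snd ext_fst)
    qed (rule ext_fst, simp)
  qed
  then have "\<exists>b. \<forall>x. E x b \<longleftrightarrow> E x a \<and> R' (s'(0 := x))" by (rule separation_dfn_False)
  ultimately show ?thesis by blast
qed

lemma collection_dfn:
  assumes "dfn True (ext (ext constants)) (\<lambda>p. R (snd (fst p)) (snd p))"
    and "\<And>x. E x a \<Longrightarrow> \<exists>y. R x y"
  shows "\<exists>c. \<forall>x. E x a \<longrightarrow> (\<exists>y. E y c \<and> R x y)"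
proof -
  from dfn_pair_normal[OF assms(1)] obtain \<phi> s where
    \<phi>: "\<phi> \<in> Bounded True" "\<And>x y. R x y \<longleftrightarrow> lsat E \<phi> (s(0 := x, 1 := y))" by metis
  then show ?thesis
    using Collection assms(2)
    unfolding L_Collection_def collection_def Bounded_True
    by (auto dest!: bspec[of _ _ \<phi>] spec[of _ s] spec[of _ "0::nat"] spec[of _ "1::nat"])
qed

section \<open>Closure properties and schemes for \<open>\<Sigma>\<^sub>1\<^sup>\<P>\<close>
  relations\<close>

definition sigma :: "('c \<Rightarrow> 'm) set \<Rightarrow> ('c \<Rightarrow> bool) \<Rightarrow> bool" where
  "sigma V R \<longleftrightarrow> (\<exists>Q. dfn True (ext V) (\<lambda>p. Q (fst p) (snd p)) \<and> (\<forall>c. R c \<longleftrightarrow> (\<exists>w. Q c w)))"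

lemma sigmaI:
  "dfn True (ext V) (\<lambda>p. Q (fst p) (snd p)) \<Longrightarrow> (\<And>c. R c \<longleftrightarrow> (\<exists>w. Q c w)) \<Longrightarrow> sigma V R"
  unfolding sigma_def by blast

lemma sigma_dfn:
  assumes "dfn True V R" shows "sigma V R"
proof -
  have "dfn True (ext V) (\<lambda>p. R (fst p))" by (rule dfn_subst[OF assms ext_fst])
  then show ?thesis by (rule sigmaI) simp
qed

lemma sigma_subst:
  assumes R: "sigma V R" and g: "\<And>f. f \<in> V \<Longrightarrow> (\<lambda>d. f (g d)) \<in> V'"
  shows "sigma V' (\<lambda>d. R (g d))"
proof -
  obtain Q where Q: "dfn True (ext V) (\<lambda>p. Q (fst p) (snd p))" "\<forall>c. R c \<longleftrightarrow> (\<exists>w. Q c w)"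
    using R unfolding sigma_def by blast
  have "dfn True (ext V') (\<lambda>p. Q (g (fst p)) (snd p))"
    using Q(1) by (rule dfn_subst_pair) (auto intro: ext_snd ext_fst[OF g])
  then show ?thesis by (rule sigmaI) (use Q(2) in blast)
qed

lemma sigma_subst_pair:
  assumes "sigma (ext V) (\<lambda>p. Q (fst p) (snd p))"
    and "\<And>h. h \<in> V \<Longrightarrow> (\<lambda>d. h (a d)) \<in> V'" "(\<lambda>d. b d) \<in> V'"
  shows "sigma V' (\<lambda>d. Q (a d) (b d))"
  using sigma_subst[OF assms(1), of "\<lambda>d. (a d, b d)"] ext_pair[of _ V a V' b, OF _ assms(2,3)] by simp

lemma sigma_binary:
  assumes "sigma (ext (ext constants)) (\<lambda>p. R (snd (fst p)) (snd p))"
    and "\<And>k. (\<lambda>c. k) \<in> V" "a \<in> V" "b \<in> V"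
  shows "sigma V (\<lambda>c. R (a c) (b c))"
proof -
  have "(\<lambda>d. f (((), a d), b d)) \<in> V" if "f \<in> ext (ext constants)" for f
    using that assms by (auto simp: ext_def)
  from sigma_subst[OF assms(1), of "\<lambda>d. (((), a d), b d)", OF this] show ?thesis by simp
qed

text \<open>Two unbounded witnesses are contracted to one: both are sought among the elements of a
  single set, and an unordered pair is always such a set.\<close>

lemma sigma_ex:
  assumes "sigma (ext V) (\<lambda>p. R (fst p) (snd p))"
  shows "sigma V (\<lambda>c. \<exists>v. R c v)"
proof -
  obtain Q where Q: "dfn True (ext (ext V)) (\<lambda>p. Q (fst p) (snd p))"
    "\<forall>p. R (fst p) (snd p) \<longleftrightarrow> (\<exists>w. Q p w)"
    using assms unfolding sigma_def by blast
  have "dfn True (ext V) (\<lambda>p. \<exists>v. E v (snd p) \<and> (\<exists>w. E w (snd p) \<and> Q (fst p, v) w))"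
    by (intro dfn_intros dfn_subst_pair[OF Q(1)]) (auto intro!: ext_snd ext_fst elim: ext_pair)
  moreover have "(\<exists>v. R c v) \<longleftrightarrow> (\<exists>u. \<exists>v. E v u \<and> (\<exists>w. E w u \<and> Q (c, v) w))" (is "?l \<longleftrightarrow> ?r") for c
  proof
    assume ?l
    then obtain v w where "Q (c, v) w" using Q(2) by fastforce
    then show ?r by (intro exI[of _ "upair v w"] exI[of _ v] conjI exI[of _ w]) simp_all
  next
    assume ?r
    then obtain v w where "Q (c, v) w" by blast
    then show ?l using Q(2)[rule_format, of "(c, v)"] by auto
  qed
  ultimately show ?thesis
    by (rule sigmaI[where Q = "\<lambda>c u. \<exists>v. E v u \<and> (\<exists>w. E w u \<and> Q (c, v) w)"])
qed

lemma sigma_conj: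
  assumes "sigma V R" "sigma V S" shows "sigma V (\<lambda>c. R c \<and> S c)"
proof -
  obtain Q where Q: "dfn True (ext V) (\<lambda>p. Q (fst p) (snd p))" "\<forall>c. R c \<longleftrightarrow> (\<exists>w. Q c w)"
    using assms(1) unfolding sigma_def by blast
  obtain T where T: "dfn True (ext V) (\<lambda>p. T (fst p) (snd p))" "\<forall>c. S c \<longleftrightarrow> (\<exists>w. T c w)"
    using assms(2) unfolding sigma_def by blast
  have "sigma V (\<lambda>c. \<exists>v. \<exists>w. Q c v \<and> T c w)"
    by (intro sigma_ex sigma_dfn dfn_conj dfn_subst_pair[OF Q(1)] dfn_subst_pair[OF T(1)])
      (auto intro!: ext_snd ext_fst)
  then show ?thesis using Q(2) T(2) by simp
qed

lemma sigma_disj: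
  assumes "sigma V R" "sigma V S" shows "sigma V (\<lambda>c. R c \<or> S c)"
proof -
  obtain Q where Q: "dfn True (ext V) (\<lambda>p. Q (fst p) (snd p))" "\<forall>c. R c \<longleftrightarrow> (\<exists>w. Q c w)"
    using assms(1) unfolding sigma_def by blast
  obtain T where T: "dfn True (ext V) (\<lambda>p. T (fst p) (snd p))" "\<forall>c. S c \<longleftrightarrow> (\<exists>w. T c w)"
    using assms(2) unfolding sigma_def by blast
  have "dfn True (ext V) (\<lambda>p. Q (fst p) (snd p) \<or> T (fst p) (snd p))" by (rule dfn_disj[OF Q(1) T(1)])
  then show ?thesis using Q(2) T(2)
    by (intro sigmaI[where Q = "\<lambda>c w. Q c w \<or> T c w"]) auto
qed

lemma sigma_bex:
  assumes "f \<in> V" "sigma (ext V) (\<lambda>p. R (fst p) (snd p))"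
  shows "sigma V (\<lambda>c. \<exists>v. E v (f c) \<and> R c v)"
  using assms by (intro sigma_ex sigma_conj sigma_dfn[OF dfn_mem] ext_snd ext_fst)

text \<open>Collection in \<M> bounds the witnesses for all \<open>v\<close> by one set
  \<open>C\<close>, which moves the unbounded quantifier in front of the bounded one.\<close>

lemma sigma_ball:
  assumes "f \<in> V" "sigma (ext V) (\<lambda>p. R (fst p) (snd p))"
  shows "sigma V (\<lambda>c. \<forall>v. E v (f c) \<longrightarrow> R c v)"
proof -
  obtain Q where Q: "dfn True (ext (ext V)) (\<lambda>p. Q (fst p) (snd p))"
    "\<forall>p. R (fst p) (snd p) \<longleftrightarrow> (\<exists>w. Q p w)"
    using assms(2) unfolding sigma_def by blast
  have "dfn True (ext V) (\<lambda>p. \<forall>v. E v (f (fst p)) \<longrightarrow> (\<exists>w. E w (snd p) \<and> Q (fst p, v) w))"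
    by (intro dfn_intros dfn_subst_pair[OF Q(1)] \<open>f \<in> V\<close>) (auto intro!: ext_snd ext_fst elim: ext_pair)
  moreover have "(\<forall>v. E v (f c) \<longrightarrow> R c v) \<longleftrightarrow>
      (\<exists>C. \<forall>v. E v (f c) \<longrightarrow> (\<exists>w. E w C \<and> Q (c, v) w))" (is "?l \<longleftrightarrow> ?r") for c
  proof
    assume ?l
    then have "\<And>v. E v (f c) \<Longrightarrow> \<exists>w. Q (c, v) w" using Q(2) by fastforce
    moreover have "dfn True (ext (ext constants)) (\<lambda>p. Q (c, snd (fst p)) (snd p))"
      by (intro dfn_subst_pair[OF Q(1)]) (auto intro!: ext_snd ext_fst elim: ext_pair)
    ultimately show ?r by (intro collection_dfn)
  next
    assume ?r
    then show ?l using Q(2) by force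
  qed
  ultimately show ?thesis
    by (rule sigmaI[where Q = "\<lambda>c C. \<forall>v. E v (f c) \<longrightarrow> (\<exists>w. E w C \<and> Q (c, v) w)"])
qed

text \<open>What is collected are sets containing both a value and the witness that certifies it;
  the union of the collected family then contains the values.\<close>

lemma collection_sigma:
  assumes "sigma (ext (ext constants)) (\<lambda>p. R (snd (fst p)) (snd p))"
    and "\<And>x. E x a \<Longrightarrow> \<exists>y. R x y"
  shows "\<exists>c. \<forall>x. E x a \<longrightarrow> (\<exists>y. E y c \<and> R x y)"
proof -
  obtain Q where Q: "dfn True (ext (ext (ext constants))) (\<lambda>p. Q (fst p) (snd p))"
    "\<And>p. R (snd (fst p)) (snd p) \<longleftrightarrow> (\<exists>w. Q p w)"
    using assms(1) unfolding sigma_def by blast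
  have Q2: "R x y \<longleftrightarrow> (\<exists>w. Q (((), x), y) w)" for x y using Q(2)[of "(((), x), y)"] by simp
  have "dfn True (ext (ext constants))
      (\<lambda>p. \<exists>y. E y (snd p) \<and> (\<exists>w. E w (snd p) \<and> Q (((), snd (fst p)), y) w))"
    by (intro dfn_intros dfn_subst_pair[OF Q(1)]) (auto intro!: ext_snd ext_fst elim!: ext_pair)
  then have "\<exists>c. \<forall>x. E x a \<longrightarrow> (\<exists>u. E u c \<and> (\<exists>y. E y u \<and> (\<exists>w. E w u \<and> Q (((), x), y) w)))"
  proof (rule collection_dfn)
    fix x
    assume "E x a"
    then obtain y w where "Q (((), x), y) w" using assms(2) Q2 by blast
    then show "\<exists>u. \<exists>y. E y u \<and> (\<exists>w. E w u \<and> Q (((), x), y) w)"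
      by (intro exI[of _ "upair y w"] exI[of _ y] conjI exI[of _ w]) simp_all
  qed
  then obtain c where "\<forall>x. E x a \<longrightarrow> (\<exists>u. E u c \<and> (\<exists>y. E y u \<and> (\<exists>w. E w u \<and> Q (((), x), y) w)))"
    by blast
  then have "\<forall>x. E x a \<longrightarrow> (\<exists>y. E y (bigun c) \<and> R x y)" unfolding E_bigun Q2 by blast
  then show ?thesis ..
qed

text \<open>For each \<open>x\<close> in \<open>a\<close> there is a witness either of
  \<open>R x\<close> or of its negation. Once these are collected in \<open>c\<close>, the relation
  \<open>R\<close> holds at \<open>x\<close> exactly if it has a witness in \<open>c\<close>, which
  is a bounded condition.\<close>

lemma separation_delta:
  assumes "sigma (ext constants) (\<lambda>p. R (snd p))" "sigma (ext constants) (\<lambda>p. \<not> R (snd p))"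
  shows "\<exists>b. \<forall>x. E x b \<longleftrightarrow> E x a \<and> R x"
proof -
  obtain Q where Q: "dfn True (ext (ext constants)) (\<lambda>p. Q (fst p) (snd p))"
    "\<And>p. R (snd p) \<longleftrightarrow> (\<exists>w. Q p w)"
    using assms(1) unfolding sigma_def by blast
  obtain T where T: "dfn True (ext (ext constants)) (\<lambda>p. T (fst p) (snd p))"
    "\<And>p. \<not> R (snd p) \<longleftrightarrow> (\<exists>w. T p w)"
    using assms(2) unfolding sigma_def by blast
  have Q2: "R x \<longleftrightarrow> (\<exists>w. Q ((), x) w)" and T2: "\<not> R x \<longleftrightarrow> (\<exists>w. T ((), x) w)" for x
    using Q(2)[of "((), x)"] T(2)[of "((), x)"] by simp_all
  have "dfn True (ext (ext constants)) (\<lambda>p. Q ((), snd (fst p)) (snd p) \<or> T ((), snd (fst p)) (snd p))"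
    by (intro dfn_disj dfn_subst_pair[OF Q(1)] dfn_subst_pair[OF T(1)])
      (auto intro!: ext_snd ext_fst elim!: ext_pair)
  then have "\<exists>c. \<forall>x. E x a \<longrightarrow> (\<exists>w. E w c \<and> (Q ((), x) w \<or> T ((), x) w))"
    by (rule collection_dfn) (use Q2 T2 in blast)
  then obtain c where c: "\<forall>x. E x a \<longrightarrow> (\<exists>w. E w c \<and> (Q ((), x) w \<or> T ((), x) w))" by blast
  have "dfn True (ext constants) (\<lambda>p. \<exists>w. E w c \<and> Q ((), snd p) w)"
    by (intro dfn_bex dfn_subst_pair[OF Q(1)]) (auto intro!: ext_snd ext_fst elim!: ext_pair)
  then have "\<exists>b. \<forall>x. E x b \<longleftrightarrow> E x a \<and> (\<exists>w. E w c \<and> Q ((), x) w)" by (rule separation_dfn)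
  then show ?thesis using c Q2 T2 by metis
qed

lemma foundation_sigma:
  assumes "sigma (ext constants) (\<lambda>p. R (snd p))" "R x"
  shows "\<exists>y. R y \<and> (\<forall>x. E x y \<longrightarrow> \<not> R x)"
proof -
  obtain Q where Q: "dfn True (ext (ext constants)) (\<lambda>p. Q (fst p) (snd p))"
    "\<And>p. R (snd p) \<longleftrightarrow> (\<exists>w. Q p w)"
    using assms(1) unfolding sigma_def by blast
  have "dfn True (ext (ext constants)) (\<lambda>p. Q ((), snd (fst p)) (snd p))"
    by (intro dfn_subst_pair[OF Q(1)]) (auto intro!: ext_snd ext_fst elim!: ext_pair)
  from dfn_pair_normal[OF this] obtain \<phi> s where
    \<phi>: "\<phi> \<in> Bounded True" "\<And>x y. Q ((), x) y \<longleftrightarrow> lsat E \<phi> (s(0 := x, 1 := y))" by metis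
  have "R x \<longleftrightarrow> lsat E (LEx 1 \<phi>) (s(0 := x))" for x
    using Q(2)[of "((), x)"] \<phi>(2) by simp
  moreover have "LEx 1 \<phi> \<in> LSigma1P" using \<phi>(1) by (auto intro: LSigma1P.intros simp: Bounded_True)
  ultimately show ?thesis
    using Foundation assms(2) unfolding L_Foundation_def foundation_def
    by (auto simp del: lsat.simps dest!: bspec[of _ _ "LEx 1 \<phi>"] spec[of _ s] spec[of _ "0::nat"])
qed


section \<open>Codes\<close>

definition zero where "zero = (SOME x. \<forall>z. \<not> E z x)"

lemma not_E_zero [simp]: "\<not> E z zero"
proof -
  have "dfn False (ext constants) (\<lambda>p. False)" by (rule dfn_const) (auto simp: ext_def)
  from separation_dfn_False[OF this] have "\<exists>x. \<forall>z. \<not> E z x" by simp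
  from someI_ex[OF this] show ?thesis unfolding zero_def by blast
qed

definition sing where "sing x = upair x x"

lemma E_sing [simp]: "E y (sing x) \<longleftrightarrow> y = x"
  by (simp add: sing_def)

lemma sing_inject [simp]: "sing x = sing y \<longleftrightarrow> x = y"
  by (metis E_sing)

text \<open>The second marker must not be a singleton, since singletons code urelements; this
  excludes \<open>sing zero\<close>.\<close>

definition two where "two = upair zero (sing zero)"

lemma two_neq_zero [simp]: "two \<noteq> zero" "zero \<noteq> two"
  using E_upair[of zero zero "sing zero"] unfolding two_def by (metis not_E_zero)+

lemma sing_neq_zero [simp]: "sing x \<noteq> zero" "zero \<noteq> sing x"
  by (metis E_sing not_E_zero)+

lemma sing_neq_two [simp]: "sing x \<noteq> two" "two \<noteq> sing x"
proof -
  have "E zero two" "E (sing zero) two" by (simp_all add: two_def)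
  then show "sing x \<noteq> two" "two \<noteq> sing x" by (metis E_sing sing_neq_zero(1))+
qed

text \<open>
  The urelement \<open>x\<close> is coded by its singleton, a set by any \<open>z\<close> that contains \<open>zero\<close> and \<open>two\<close>: these
  two code nothing, so they mark \<open>z\<close> as a code of a set, and the other elements of \<open>z\<close> are the codes
  of the elements.  With singletons as codes, those of the elements of \<open>x\<close> are subsets of \<open>x\<close>, so they
  form a set by Separation from the power set.
\<close>

definition setcode where "setcode z \<longleftrightarrow> E zero z \<and> E two z"

definition cmem where "cmem y z \<longleftrightarrow> setcode z \<and> E y z \<and> y \<noteq> zero \<and> y \<noteq> two"

text \<open>Keeps \<open>two\<close> from being a set code, which would have to contain
  \<open>two\<close>.\<close>

lemma not_E_two_two [simp]: "\<not> E two two"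
proof -
  have "E two two \<longleftrightarrow> two = zero \<or> two = sing zero" by (subst (2) two_def) simp
  then show ?thesis by simp
qed

lemma not_setcode [simp]: "\<not> setcode zero" "\<not> setcode two" "\<not> setcode (sing x)"
  by (auto simp: setcode_def)

lemma not_cmem [simp]: "\<not> cmem y zero" "\<not> cmem y two" "\<not> cmem y (sing x)"
  "\<not> cmem zero z" "\<not> cmem two z"
  by (auto simp: cmem_def)

lemma setcode_ext: "setcode z \<Longrightarrow> setcode z' \<Longrightarrow> (\<And>y. cmem y z \<longleftrightarrow> cmem y z') \<Longrightarrow> z = z'"
  by (rule E_ext) (metis cmem_def setcode_def)

definition mkset where "mkset a = union a (upair zero two)"

lemma setcode_mkset [simp]: "setcode (mkset a)"
  by (simp add: setcode_def mkset_def)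

lemma cmem_mkset [simp]: "cmem y (mkset a) \<longleftrightarrow> E y a \<and> y \<noteq> zero \<and> y \<noteq> two"
  by (auto simp: cmem_def) (auto simp: mkset_def)

text \<open>The induction is that of the metatheory and need not be expressible over \<M>. Every
  element of \<M>, even an ill-founded one, has a code as an urelement; well-foundedness is asked
  only of the descent through set codes.\<close>

inductive coded where
  ur: "coded (sing x)"
| set: "setcode z \<Longrightarrow> (\<And>y. cmem y z \<Longrightarrow> coded y) \<Longrightarrow> coded z"

lemma coded_cmem: "coded z \<Longrightarrow> cmem y z \<Longrightarrow> coded y"
  by (erule coded.cases) auto

lemma not_coded [simp]: "\<not> coded zero" "\<not> coded two"
  by (auto elim: coded.cases)

text \<open>The Mostowski collapse of the well-founded codes, as a relation.\<close>

inductive den :: "'m \<Rightarrow> ('m, 'k) V \<Rightarrow> bool" where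
  ur: "den (sing x) (Ur x)"
| set: "setcode z \<Longrightarrow> v \<notin> range Ur \<Longrightarrow> (\<And>y. cmem y z \<Longrightarrow> \<exists>x. vmem x v \<and> den y x) \<Longrightarrow>
    (\<And>x. vmem x v \<Longrightarrow> \<exists>y. cmem y z \<and> den y x) \<Longrightarrow> den z v"

lemma den_setcode: "den z v \<Longrightarrow> setcode z \<longleftrightarrow> v \<notin> range Ur"
  by (erule den.cases) auto

lemma den_functional: "den z v \<Longrightarrow> den z v' \<Longrightarrow> v = v'"
proof (induction arbitrary: v' rule: den.induct)
  case (ur x)
  then show ?case by cases auto
next
  case (set z v)
  from set.prems show ?case
  proof cases
    case ur
    with set.hyps show ?thesis by simp
  next
    case v': set
    show ?thesis
    proof (rule V_extensionality)
      show "vmem x v \<longleftrightarrow> vmem x v'" for x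
        using set.IH v' by metis
    qed (use set.hyps v' in auto)
  qed
qed

text \<open>Codes are unique because every set code contains both markers, so that it is determined
  by its proper elements.\<close>

lemma den_inject: "den z v \<Longrightarrow> den z' v \<Longrightarrow> z = z'"
proof (induction arbitrary: z' rule: den.induct)
  case (ur x)
  then show ?case by cases auto
next
  case (set z v)
  from set.prems show ?case
  proof cases
    case ur
    with set.hyps show ?thesis by simp
  next
    case z': set
    show ?thesis
      by (rule setcode_ext) (use set.hyps set.IH z' in metis)+
  qed
qed

lemma coded_den: "coded z \<Longrightarrow> \<exists>v :: ('m, 'k) V. den z v"
proof (induction rule: coded.induct)
  case (ur x)
  show ?case by (blast intro: den.ur)
next
  case (set z)
  then obtain f :: "'m \<Rightarrow> ('m, 'k) V" where f: "\<And>y. cmem y z \<Longrightarrow> den y (f y)" by metis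
  \<comment> \<open>A code has at most as many elements as \<M>, so the first summand of the
    branching type is large enough.\<close>
  let ?h = "case_sum f undefined :: 'm + nat + 'k \<Rightarrow> ('m, 'k) V"
  obtain a :: "('m, 'k) V" where a: "a \<notin> range Ur" "\<forall>x. vmem x a \<longleftrightarrow> x \<in> ?h ` Inl ` {y. cmem y z}"
    using V_comprehension[of ?h "Inl ` {y. cmem y z}"] by (elim exE conjE)
  have "den z a" using set.hyps(1) a(1) by (rule den.set) (use f a(2) in \<open>auto simp: image_image\<close>)
  then show ?case ..
qed

lemma den_coded: "den z v \<Longrightarrow> coded z"
  by (induction rule: den.induct) (auto intro: coded.intros)

definition obj :: "'m \<Rightarrow> ('m, 'k) V" where "obj z = (THE v. den z v)"

lemma den_obj: "coded z \<Longrightarrow> den z (obj z)"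
  unfolding obj_def using coded_den den_functional by (metis theI)

lemma obj_eqI: "den z v \<Longrightarrow> obj z = v"
  using den_obj den_coded den_functional by blast

lemma obj_sing [simp]: "obj (sing x) = Ur x"
  by (rule obj_eqI) (rule den.ur)

lemma obj_inject: "coded y \<Longrightarrow> coded z \<Longrightarrow> obj y = (obj z :: ('m, 'k) V) \<longleftrightarrow> y = z"
  using den_obj den_inject by metis

lemma obj_setcode: "coded z \<Longrightarrow> obj z \<notin> range (Ur :: 'm \<Rightarrow> ('m, 'k) V) \<longleftrightarrow> setcode z"
  using den_obj den_setcode by blast

lemma coded_sing_iff: "coded z \<Longrightarrow> setcode z \<longleftrightarrow> (\<forall>x. z \<noteq> sing x)"
  by (erule coded.cases) auto

lemma vmem_obj:
  fixes x :: "('m, 'k) V"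
  assumes "coded z" shows "vmem x (obj z) \<longleftrightarrow> (\<exists>y. cmem y z \<and> x = obj y)"
proof -
  have "den z (obj z :: ('m, 'k) V)" using assms by (rule den_obj)
  then show ?thesis
  proof cases
  case (ur p)
  then show ?thesis by simp
next
  case set
  then show ?thesis by (metis obj_eqI)
qed
qed

section \<open>The operations F and P on codes\<close>

definition F_code where
  "F_code z = (SOME w. \<forall>y. E y w \<longleftrightarrow> y = zero \<or> y = two \<or> (\<exists>x v. z = sing x \<and> E v x \<and> y = sing v))"

text \<open>Since all set codes share the markers, inclusion of the coded sets is plain inclusion of
  the codes. If \<open>z\<close> is not a set code, no set code is included in it, and only the
  markers remain.\<close>

definition P_code where
  "P_code z = (SOME w. \<forall>y. E y w \<longleftrightarrow> y = zero \<or> y = two \<or> (setcode y \<and> (\<forall>v. E v y \<longrightarrow> E v z)))"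

lemma sing_iff: "y = sing v \<longleftrightarrow> E v y \<and> (\<forall>w. E w y \<longrightarrow> w = v)"
proof
  show "E v y \<and> (\<forall>w. E w y \<longrightarrow> w = v) \<Longrightarrow> y = sing v" by (intro E_ext) (metis E_sing)
qed simp

lemma E_mkset: "E y (mkset a) \<longleftrightarrow> E y a \<or> y = zero \<or> y = two"
  by (simp add: mkset_def)

lemma E_F_code: "E y (F_code z) \<longleftrightarrow> y = zero \<or> y = two \<or> (\<exists>x v. z = sing x \<and> E v x \<and> y = sing v)"
proof -
  have "\<exists>w. \<forall>y. E y w \<longleftrightarrow> y = zero \<or> y = two \<or> (\<exists>x v. z = sing x \<and> E v x \<and> y = sing v)"
  proof (cases "\<exists>x. z = sing x")
    case True
    then obtain x where x: "z = sing x" by blast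
    have "dfn True (ext constants) (\<lambda>p. \<exists>v. E v x \<and> snd p = sing v)"
      unfolding sing_iff by (intro dfn_intros UNIV_I)
    from separation_dfn[OF this, of "Pw x"] obtain b where
      "\<forall>y. E y b \<longleftrightarrow> (\<forall>v. E v y \<longrightarrow> E v x) \<and> (\<exists>v. E v x \<and> y = sing v)" by auto
    then show ?thesis by (intro exI[of _ "mkset b"]) (auto simp: x E_mkset)
  next
    case False
    then show ?thesis by (intro exI[of _ "mkset zero"]) (auto simp: E_mkset)
  qed
  from someI_ex[OF this] show ?thesis unfolding F_code_def by blast
qed

lemma E_P_code: "E y (P_code z) \<longleftrightarrow> y = zero \<or> y = two \<or> (setcode y \<and> (\<forall>v. E v y \<longrightarrow> E v z))"
proof -
  have "dfn True (ext constants) (\<lambda>p. setcode (snd p))"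
    unfolding setcode_def by (intro dfn_intros UNIV_I)
  from separation_dfn[OF this, of "Pw z"] obtain b where
    "\<forall>y. E y b \<longleftrightarrow> (\<forall>v. E v y \<longrightarrow> E v z) \<and> setcode y" by auto
  then have "\<exists>w. \<forall>y. E y w \<longleftrightarrow> y = zero \<or> y = two \<or> (setcode y \<and> (\<forall>v. E v y \<longrightarrow> E v z))"
    by (intro exI[of _ "mkset b"]) (auto simp: E_mkset)
  from someI_ex[OF this] show ?thesis unfolding P_code_def by blast
qed

lemma F_code_dfn: "dfn True (ext (ext constants)) (\<lambda>p. snd p = F_code (snd (fst p)))"
proof -
  have "w = F_code z \<longleftrightarrow> E zero w \<and> E two w \<and>
      (\<forall>y. E y w \<longrightarrow> y = zero \<or> y = two \<or> (\<exists>x. E x z \<and> z = sing x \<and> (\<exists>v. E v x \<and> y = sing v))) \<and>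
      (\<forall>x. E x z \<longrightarrow> z = sing x \<longrightarrow> (\<forall>v. E v x \<longrightarrow> (\<exists>y. E y w \<and> y = sing v)))"
    (is "_ \<longleftrightarrow> ?r") for w z
  proof
    show "w = F_code z \<Longrightarrow> ?r" by (auto simp: E_F_code)
    assume r: ?r
    show "w = F_code z"
    proof (rule E_ext)
      show "E y w \<longleftrightarrow> E y (F_code z)" for y
        unfolding E_F_code using r by (elim conjE) (metis E_sing)
    qed
  qed
  then show ?thesis unfolding sing_iff by (simp only:) (intro dfn_intros UNIV_I)
qed

text \<open>The last conjunct, that every set code included in \<open>z\<close> lies in
  \<open>w\<close>, is where the quantifier bounded by inclusion enters.\<close>

lemma P_code_dfn: "dfn True (ext (ext constants)) (\<lambda>p. snd p = P_code (snd (fst p)))"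
proof -
  have "w = P_code z \<longleftrightarrow> E zero w \<and> E two w \<and>
      (\<forall>y. E y w \<longrightarrow> y = zero \<or> y = two \<or> (E zero y \<and> E two y \<and> (\<forall>v. E v y \<longrightarrow> E v z))) \<and>
      (\<forall>y. (\<forall>v. E v y \<longrightarrow> E v z) \<longrightarrow> E zero y \<and> E two y \<longrightarrow> E y w)"
    (is "_ \<longleftrightarrow> ?r") for w z
  proof
    show "w = P_code z \<Longrightarrow> ?r" by (auto simp: E_P_code setcode_def)
    assume r: ?r
    show "w = P_code z"
    proof (rule E_ext)
      show "E y w \<longleftrightarrow> E y (P_code z)" for y
        unfolding E_P_code setcode_def using r by (elim conjE) metis
    qed
  qed
  then show ?thesis by (simp only:) (intro dfn_intros dfn_ball_subset UNIV_I TrueI)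
qed

lemma setcode_F_code [simp]: "setcode (F_code z)" and setcode_P_code [simp]: "setcode (P_code z)"
  by (simp_all add: setcode_def E_F_code E_P_code)

lemma cmem_F_code [simp]: "cmem y (F_code z) \<longleftrightarrow> (\<exists>x v. z = sing x \<and> E v x \<and> y = sing v)"
  by (auto simp: cmem_def E_F_code)

lemma cmem_P_code [simp]: "cmem y (P_code z) \<longleftrightarrow> setcode y \<and> (\<forall>v. E v y \<longrightarrow> E v z)"
  using not_setcode by (fastforce simp: cmem_def E_P_code)

lemma coded_F_code: "coded (F_code z)"
  by (rule coded.set) (auto intro: coded.ur)

text \<open>A set code included in a well-founded code has only elements of that code, so it is
  well-founded too. Forming power sets in \<M> therefore never leaves the well-founded
  codes.\<close>

lemma coded_P_code:
  assumes "coded z" shows "coded (P_code z)"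
proof (rule coded.set)
  fix y assume "cmem y (P_code z)"
  then have y: "setcode y" "\<forall>v. E v y \<longrightarrow> E v z" by auto
  then have "setcode z" by (auto simp: setcode_def)
  show "coded y"
  proof (rule coded.set[OF y(1)])
    show "coded v" if "cmem v y" for v
      using that y(2) \<open>setcode z\<close> by (intro coded_cmem[OF assms]) (auto simp: cmem_def)
  qed
qed simp

text \<open>A definable stand-in for the cover: its domain is all of \<M>, including ill-founded
  codes and elements that code nothing.\<close>

definition codes :: "('f \<Rightarrow> 'm \<Rightarrow> 'm) \<Rightarrow> ('f, 'm) astruct" where
  "codes G = \<lparr>dmn = UNIV, urs = range sing, erel = (\<lambda>x y. \<exists>p q. x = sing p \<and> y = sing q \<and> E p q),
    mem = cmem, fn = G\<rparr>"

lemma codes_simps [simp]: "dmn (codes G) = UNIV" "urs (codes G) = range sing"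
  "erel (codes G) x y \<longleftrightarrow> (\<exists>p q. x = sing p \<and> y = sing q \<and> E p q)"
  "mem (codes G) = cmem" "fn (codes G) = G"
  by (simp_all add: codes_def)

end

text \<open>Function symbols enter only through two properties, a bounded definition of the graph
  and preservation of well-founded codes. One argument thus serves both languages.\<close>

locale coded_functions = model E for E :: "'m \<Rightarrow> 'm \<Rightarrow> bool" +
  fixes G :: "'f \<Rightarrow> 'm \<Rightarrow> 'm"
  assumes G_dfn: "\<And>f. dfn True (ext (ext constants)) (\<lambda>p. snd p = G f (snd (fst p)))"
    and coded_G: "\<And>f z. coded z \<Longrightarrow> coded (G f z)"
begin

lemma sigma_G:
  assumes "\<And>k. (\<lambda>c. k) \<in> V" "b \<in> V" "a \<in> V"
  shows "sigma V (\<lambda>c. b c = G f (a c))"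
  using dfn_binary[OF G_dfn assms(1,3,2), of f] by (rule sigma_dfn)

lemma projections_ext_const: "(\<lambda>p. k) \<in> ext projections" "(\<lambda>p. k) \<in> ext (ext projections)"
  "(\<lambda>p. k) \<in> ext (ext (ext projections))"
  by (auto intro!: ext_fst projections_intros)

lemma sigma_val: "sigma (ext projections) (\<lambda>p. snd p = val (codes G) (fst p) t)"
proof (induction t)
  case (Var x)
  show ?case by (auto intro!: sigma_dfn dfn_intros projections_intros)
next
  case (App f t)
  have "sigma (ext projections) (\<lambda>p. \<exists>u. u = val (codes G) (fst p) t \<and> snd p = G f u)"
  proof (intro sigma_ex sigma_conj)
    show "sigma (ext (ext projections)) (\<lambda>p. snd p = val (codes G) (fst (fst p)) t)"
      by (rule sigma_subst_pair[where Q = "\<lambda>s u. u = val (codes G) s t", OF App])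
        (auto intro: ext_snd ext_fst)
    show "sigma (ext (ext projections)) (\<lambda>p. snd (fst p) = G f (snd p))"
      by (rule sigma_G) (auto intro: ext_snd ext_fst projections_ext_const)
  qed
  then show ?case by simp
qed

lemma sigma_atom:
  assumes "dfn True (ext (ext constants)) (\<lambda>p. R (snd (fst p)) (snd p))"
  shows "sigma projections (\<lambda>s. R (val (codes G) s t) (val (codes G) s u))"
proof -
  let ?V = "ext (ext projections)"
  have "sigma projections (\<lambda>s. \<exists>a b. a = val (codes G) s t \<and> b = val (codes G) s u \<and> R a b)"
  proof (intro sigma_ex sigma_conj)
    show "sigma ?V (\<lambda>p. snd (fst p) = val (codes G) (fst (fst p)) t)"
      by (rule sigma_subst_pair[where Q = "\<lambda>s u. u = val (codes G) s t", OF sigma_val])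
        (auto intro: ext_snd ext_fst)
    show "sigma ?V (\<lambda>p. snd p = val (codes G) (fst (fst p)) u)"
      by (rule sigma_subst_pair[where Q = "\<lambda>s v. v = val (codes G) s u", OF sigma_val])
        (auto intro: ext_snd ext_fst)
    show "sigma ?V (\<lambda>p. R (snd (fst p)) (snd p))"
      by (intro sigma_dfn dfn_binary[OF assms] ext_snd ext_fst projections_ext_const)
  qed
  then show ?thesis by simp
qed

lemma sigma_update:
  assumes "sigma projections R"
  shows "sigma (ext projections) (\<lambda>p. R ((fst p)(x := snd p)))"
  using assms
proof (rule sigma_subst)
  fix f :: "(nat \<Rightarrow> 'm) \<Rightarrow> 'm"
  assume "f \<in> projections"
  then show "(\<lambda>d. f ((fst d)(x := snd d))) \<in> ext projections"
  proof (rule projections_subst)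
    show "(\<lambda>d. ((fst d)(x := snd d)) i) \<in> ext projections" for i :: nat
      by (cases "i = x") (auto intro: ext_snd ext_fst projections_intros)
  qed (rule projections_ext_const)
qed

lemma val_codes_cong: "x \<notin> vars t \<Longrightarrow> val (codes G) (s(x := v)) t = val (codes G) s t"
  by (induction t) auto

text \<open>A formula and its negation are carried along together, which makes the step for negation
  trivial. Since the value \<open>u\<close> of a term exists and is unique, introducing it by an
  existential quantifier is harmless on both sides.\<close>

lemma sigma_sat:
  assumes "\<phi> \<in> Delta0"
  shows "sigma projections (sat (codes G) \<phi>) \<and> sigma projections (\<lambda>s. \<not> sat (codes G) \<phi> s)"
  using assms
proof induction
  case (1 t u)
  have "dfn True (ext (ext constants)) (\<lambda>p. cmem (snd (fst p)) (snd p))"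
    unfolding cmem_def setcode_def by (intro dfn_intros UNIV_I)
  from this dfn_not[OF this] show ?case
    by (auto intro: sigma_atom[where R = cmem] sigma_atom[where R = "\<lambda>x y. \<not> cmem x y"])
next
  case (2 t u)
  have "dfn True (ext (ext constants)) (\<lambda>p. snd (fst p) = snd p)"
    by (intro dfn_intros UNIV_I)
  from this dfn_not[OF this] show ?case
    by (auto intro: sigma_atom[where R = "(=)"] sigma_atom[where R = "(\<noteq>)"])
next
  case (3 t u)
  let ?R = "\<lambda>x y. \<exists>p q. x = sing p \<and> y = sing q \<and> E p q"
  have eq: "?R x y \<longleftrightarrow> (\<exists>p. E p x \<and> (\<exists>q. E q y \<and> x = sing p \<and> y = sing q \<and> E p q))" for x y
    by auto
  have "dfn True (ext (ext constants)) (\<lambda>p. ?R (snd (fst p)) (snd p))"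
    unfolding eq unfolding sing_iff by (intro dfn_intros UNIV_I)
  from sigma_atom[OF this] sigma_atom[where R = "\<lambda>x y. \<not> ?R x y", OF dfn_not[OF this]]
  show ?case by simp
next
  case (4 t)
  have eq: "x \<in> range sing \<longleftrightarrow> (\<exists>p. E p x \<and> x = sing p)" for x
    by auto
  have "dfn True (ext (ext constants)) (\<lambda>p. snd (fst p) \<in> range sing)"
    unfolding eq unfolding sing_iff by (intro dfn_intros UNIV_I)
  from this dfn_not[OF this] have "sigma projections (\<lambda>s. val (codes G) s t \<in> range sing)"
    "sigma projections (\<lambda>s. val (codes G) s t \<notin> range sing)"
    using sigma_atom[where R = "\<lambda>x y. x \<in> range sing"] sigma_atom[where R = "\<lambda>x y. x \<notin> range sing"]
    by blast+
  then show ?case by simp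
next
  case (5 \<phi>)
  then show ?case by simp
next
  case (6 \<phi> \<psi>)
  then show ?case unfolding sat.simps de_Morgan_conj by (intro conjI sigma_conj sigma_disj) simp_all
next
  case (7 x t \<phi>)
  have val: "sigma (ext projections) (\<lambda>p. snd p = val (codes G) (fst p) t)" by (rule sigma_val)
  have tag: "dfn True (ext (ext projections)) (\<lambda>p. cmem (snd p) (snd (fst p)))"
    unfolding cmem_def setcode_def
    by (intro dfn_intros projections_ext_const)
  have sub: "sigma (ext (ext projections)) (\<lambda>p. sat (codes G) \<phi> ((fst (fst p))(x := snd p)))"
    "sigma (ext (ext projections)) (\<lambda>p. \<not> sat (codes G) \<phi> ((fst (fst p))(x := snd p)))"
    using 7(3) by (auto intro!: ext_snd ext_fst
        sigma_subst_pair[where Q = "\<lambda>s v. sat (codes G) \<phi> (s(x := v))", OF sigma_update]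
        sigma_subst_pair[where Q = "\<lambda>s v. \<not> sat (codes G) \<phi> (s(x := v))", OF sigma_update])
  have "sigma projections (\<lambda>s. \<exists>u. u = val (codes G) s t \<and>
      (\<exists>v. E v u \<and> (cmem v u \<and> sat (codes G) \<phi> (s(x := v)))))"
    by (intro sigma_ex sigma_conj val sigma_bex sub sigma_dfn[OF tag] ext_snd)
  moreover have "sigma projections (\<lambda>s. \<exists>u. u = val (codes G) s t \<and>
      (\<forall>v. E v u \<longrightarrow> (\<not> cmem v u \<or> \<not> sat (codes G) \<phi> (s(x := v)))))"
    by (intro sigma_ex sigma_conj val sigma_ball sigma_disj sub sigma_dfn[OF dfn_not[OF tag]] ext_snd)
  moreover have "(\<exists>u. u = val (codes G) s t \<and> (\<exists>v. E v u \<and> (cmem v u \<and> sat (codes G) \<phi> (s(x := v))))) \<longleftrightarrow>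
      sat (codes G) (Exi x (And (Mem (Var x) t) \<phi>)) s" for s
    using 7(1) by (auto simp: val_codes_cong cmem_def)
  moreover have "(\<exists>u. u = val (codes G) s t \<and> (\<forall>v. E v u \<longrightarrow> (\<not> cmem v u \<or> \<not> sat (codes G) \<phi> (s(x := v))))) \<longleftrightarrow>
      \<not> sat (codes G) (Exi x (And (Mem (Var x) t) \<phi>)) s" for s
    using 7(1) by (auto simp: val_codes_cong cmem_def)
  ultimately show ?case by simp
qed

end

section \<open>Collection for well-founded codes\<close>

context model
begin

section \<open>Ordered pairs and relations inside \<M>\<close>

lemma upair_eq_iff: "upair a b = upair c d \<longleftrightarrow> (a = c \<and> b = d) \<or> (a = d \<and> b = c)"
proof
  assume "upair a b = upair c d"
  then have "x = a \<or> x = b \<longleftrightarrow> x = c \<or> x = d" for x by (metis E_upair)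
  then show "(a = c \<and> b = d) \<or> (a = d \<and> b = c)" by metis
qed (auto intro: E_ext)

definition opair where "opair x y = upair (sing x) (upair x y)"

lemma opair_inject [simp]: "opair a b = opair c d \<longleftrightarrow> a = c \<and> b = d"
  by (auto simp: opair_def sing_def upair_eq_iff)

lemma upair_iff: "d = upair u v \<longleftrightarrow> E u d \<and> E v d \<and> (\<forall>w. E w d \<longrightarrow> w = u \<or> w = v)"
proof
  show "E u d \<and> E v d \<and> (\<forall>w. E w d \<longrightarrow> w = u \<or> w = v) \<Longrightarrow> d = upair u v"
    by (intro E_ext) (metis E_upair)
qed simp

lemma dfn_sing: "y \<in> V \<Longrightarrow> x \<in> V \<Longrightarrow> dfn True V (\<lambda>c. y c = sing (x c))"
  unfolding sing_iff by (intro dfn_intros)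

lemma dfn_upair: "y \<in> V \<Longrightarrow> u \<in> V \<Longrightarrow> v \<in> V \<Longrightarrow> dfn True V (\<lambda>c. y c = upair (u c) (v c))"
  unfolding upair_iff by (intro dfn_intros)

lemma dfn_opair:
  assumes "d \<in> V" "x \<in> V" "y \<in> V" shows "dfn True V (\<lambda>c. d c = opair (x c) (y c))"
proof -
  have "d = opair x y \<longleftrightarrow> (\<exists>u. E u d \<and> (\<exists>v. E v d \<and> u = sing x \<and> v = upair x y \<and> d = upair u v))"
    for d x y by (auto simp: opair_def)
  then show ?thesis
    by (simp only:) (intro dfn_bex dfn_conj dfn_sing dfn_upair assms ext_fst ext_snd)
qed

definition rel where "rel r x y \<longleftrightarrow> E (opair x y) r"

lemma dfn_rel:
  assumes "r \<in> V" "x \<in> V" "y \<in> V" shows "dfn True V (\<lambda>c. rel (r c) (x c) (y c))"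
proof -
  have "rel r x y \<longleftrightarrow> (\<exists>d. E d r \<and> d = opair x y)" for r x y by (auto simp: rel_def)
  then show ?thesis
    by (simp only:) (intro dfn_bex dfn_opair assms ext_fst ext_snd)
qed

lemma rel_bigun: "rel r x y \<Longrightarrow> E x (bigun (bigun r))" "rel r x y \<Longrightarrow> E y (bigun (bigun r))"
proof -
  assume "rel r x y"
  then have "E (upair x y) (bigun r)" by (auto simp: rel_def opair_def)
  then show "E x (bigun (bigun r))" "E y (bigun (bigun r))" by auto
qed

lemma dfn_setcode:
  assumes "\<And>k. (\<lambda>c. k) \<in> V" "y \<in> V" shows "dfn True V (\<lambda>c. setcode (y c))"
  unfolding setcode_def by (intro dfn_intros assms)

lemma dfn_cmem:
  assumes "\<And>k. (\<lambda>c. k) \<in> V" "x \<in> V" "y \<in> V" shows "dfn True V (\<lambda>c. cmem (x c) (y c))"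
  unfolding cmem_def by (intro dfn_intros dfn_setcode assms)

text \<open>
  A simulation bounds the code-rank of \<open>y\<close> by the rank of \<open>z\<close>.  That some simulation relates \<open>y\<close> to
  \<open>z\<close> is \<open>\<Sigma>\<^sub>1\<close>; if \<open>z\<close> lies in the well-founded part of \<open>E\<close> it guarantees that \<open>y\<close> is a code, and
  it holds if \<open>y\<close> is a code and \<open>z\<close> lies outside the well-founded part.
\<close>

definition simulation where
  "simulation r \<longleftrightarrow> (\<forall>y z. rel r y z \<longrightarrow>
     (\<exists>x. y = sing x) \<or> (setcode y \<and> (\<forall>y'. cmem y' y \<longrightarrow> (\<exists>z'. E z' z \<and> rel r y' z'))))"

lemma dfn_simulation:
  assumes c: "\<And>k. (\<lambda>c. k) \<in> V" and r: "r \<in> V" shows "dfn True V (\<lambda>c. simulation (r c))"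
proof -
  have "simulation r \<longleftrightarrow> (\<forall>d. E d r \<longrightarrow> (\<forall>u. E u d \<longrightarrow> (\<forall>y. E y u \<longrightarrow> (\<forall>z. E z u \<longrightarrow> d = opair y z \<longrightarrow>
      (\<exists>x. E x y \<and> y = sing x) \<or>
      (setcode y \<and> (\<forall>y'. E y' y \<longrightarrow> cmem y' y \<longrightarrow> (\<exists>z'. E z' z \<and> rel r y' z')))))))" (is "_ \<longleftrightarrow> ?rhs r") for r
  proof
    assume "simulation r"
    then show "?rhs r" unfolding simulation_def rel_def by (metis E_sing)
  next
    assume r: "?rhs r"
    show "simulation r" unfolding simulation_def
    proof (intro allI impI)
      fix y z
      assume "rel r y z"
      then have "E (opair y z) r" "E (upair y z) (opair y z)" "E y (upair y z)" "E z (upair y z)"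
        by (auto simp: rel_def opair_def)
      from r[rule_format, OF this refl]
      show "(\<exists>x. y = sing x) \<or> (setcode y \<and> (\<forall>y'. cmem y' y \<longrightarrow> (\<exists>z'. E z' z \<and> rel r y' z')))"
        unfolding cmem_def by blast
    qed
  qed
  then show ?thesis
    by (simp only:) (intro dfn_ball dfn_bex dfn_imp dfn_disj dfn_conj dfn_opair dfn_sing dfn_rel
      dfn_setcode dfn_cmem r ext_fst ext_snd c)
qed

lemma simulation_coded:
  assumes "simulation r" "Wellfounded.accp E z" "rel r y z" shows "coded y"
  using assms(2,3)
proof (induction arbitrary: y rule: Wellfounded.accp.induct)
  case (accI z)
  then show ?case using assms(1) unfolding simulation_def by (metis coded.intros)
qed

text \<open>The induction on the code is external, so \<open>B\<close> need not be definable over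
  \<M>; only the simulation must be an element of \<M>, and Collection assembles it. The uses are
  \<open>B\<close> as equality if \<open>E\<close> is well-founded, and otherwise as ill-foundedness
  of \<open>z\<close>, where a further step down is always possible.\<close>

lemma simulation_exists:
  assumes step: "\<And>y z y'. B y z \<Longrightarrow> cmem y' y \<Longrightarrow> \<exists>z'. E z' z \<and> B y' z'"
    and "coded y" "B y z"
  shows "\<exists>r. simulation r \<and> rel r y z"
  using assms(2,3)
proof (induction arbitrary: z)
  case (ur x)
  have "simulation (sing (opair (sing x) z))" by (auto simp: simulation_def rel_def)
  then show ?case by (auto simp: rel_def intro!: exI[of _ "sing (opair (sing x) z)"])
next
  case (set y)
  have "dfn True (ext (ext constants)) (\<lambda>p. \<not> cmem (snd (fst p)) y \<or>
      (simulation (snd p) \<and> (\<exists>z'. E z' z \<and> rel (snd p) (snd (fst p)) z')))"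
    by (intro dfn_disj dfn_not dfn_conj dfn_cmem dfn_simulation dfn_bex dfn_rel ext_snd ext_fst UNIV_I)
  then have "\<exists>c. \<forall>x. E x y \<longrightarrow> (\<exists>w. E w c \<and> (\<not> cmem x y \<or>
      (simulation w \<and> (\<exists>z'. E z' z \<and> rel w x z'))))"
    by (rule collection_dfn) (use step set in blast)
  then obtain c where c: "\<And>x. cmem x y \<Longrightarrow> \<exists>w. E w c \<and> simulation w \<and> (\<exists>z'. E z' z \<and> rel w x z')"
    unfolding cmem_def by blast
  \<comment> \<open>The collecting set may contain other things than simulations, and these must be
    removed before taking the union.\<close>
  have "dfn True (ext constants) (\<lambda>p. simulation (snd p))"
    by (intro dfn_simulation ext_snd ext_fst UNIV_I)
  from separation_dfn[OF this] obtain c' where c': "\<forall>w. E w c' \<longleftrightarrow> E w c \<and> simulation w" by blast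
  define r where "r = union (bigun c') (sing (opair y z))"
  have r: "rel r a b \<longleftrightarrow> (\<exists>w. E w c \<and> simulation w \<and> rel w a b) \<or> (a = y \<and> b = z)" for a b
    unfolding rel_def r_def by (auto simp: c')
  have "simulation r" unfolding simulation_def
  proof (intro allI impI)
    fix a b
    assume "rel r a b"
    then consider w where "E w c" "simulation w" "rel w a b" | "a = y" "b = z" unfolding r by blast
    then show "(\<exists>x. a = sing x) \<or> (setcode a \<and> (\<forall>y'. cmem y' a \<longrightarrow> (\<exists>z'. E z' b \<and> rel r y' z')))"
    proof cases
      case 1
      then have "(\<exists>x. a = sing x) \<or> (setcode a \<and> (\<forall>y'. cmem y' a \<longrightarrow> (\<exists>z'. E z' b \<and> rel w y' z')))"
        unfolding simulation_def by blast
      then show ?thesis using 1(1,2) r by metis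
    next
      case 2
      then show ?thesis using r c set.hyps(1) by blast
    qed
  qed
  then show ?case using r by blast
qed

text \<open>A union of simulations is a simulation, so Collection gives one that serves all
  \<open>x\<close>. The condition \<open>K\<close> will be trivial in the well-founded case and
  membership in a fixed set in the other.\<close>

lemma simulations_union:
  assumes R: "sigma (ext (ext constants)) (\<lambda>p. R (snd (fst p)) (snd p))"
    and K: "dfn True (ext constants) (\<lambda>p. K (snd p))"
    and ex: "\<And>x. cmem x a \<Longrightarrow> \<exists>r y z. simulation r \<and> rel r y z \<and> K z \<and> R x y"
  shows "\<exists>r. simulation r \<and> (\<forall>x. cmem x a \<longrightarrow> (\<exists>y z. K z \<and> rel r y z \<and> R x y))"
proof -
  have "sigma (ext (ext constants)) (\<lambda>p. \<not> cmem (snd (fst p)) a \<or>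
      (simulation (snd p) \<and> (\<exists>y z. (rel (snd p) y z \<and> K z) \<and> R (snd (fst p)) y)))"
    by (intro sigma_disj sigma_conj sigma_ex sigma_dfn[OF dfn_not] sigma_dfn dfn_cmem dfn_simulation
        dfn_conj dfn_rel ext_snd ext_fst UNIV_I dfn_unary[OF K] sigma_binary[OF R])
  then have "\<exists>c. \<forall>x. E x a \<longrightarrow> (\<exists>r. E r c \<and> (\<not> cmem x a \<or>
      (simulation r \<and> (\<exists>y z. (rel r y z \<and> K z) \<and> R x y))))"
    by (rule collection_sigma) (use ex in blast)
  then obtain c where "\<forall>x. E x a \<longrightarrow> (\<exists>r. E r c \<and> (\<not> cmem x a \<or>
      (simulation r \<and> (\<exists>y z. (rel r y z \<and> K z) \<and> R x y))))" ..
  then have c: "\<exists>r. E r c \<and> simulation r \<and> (\<exists>y z. rel r y z \<and> K z \<and> R x y)" if "cmem x a" for x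
    using that by (metis cmem_def)
  have "dfn True (ext constants) (\<lambda>p. simulation (snd p))"
    by (intro dfn_simulation ext_snd ext_fst UNIV_I)
  from separation_dfn[OF this] obtain c' where c': "\<forall>w. E w c' \<longleftrightarrow> E w c \<and> simulation w" by blast
  have r: "rel (bigun c') x y \<longleftrightarrow> (\<exists>w. E w c \<and> simulation w \<and> rel w x y)" for x y
    unfolding rel_def by (auto simp: c')
  have "simulation (bigun c')" unfolding simulation_def
  proof (intro allI impI)
    fix y z
    assume "rel (bigun c') y z"
    then obtain w where "E w c" "simulation w" "rel w y z" unfolding r by blast
    moreover from this have "(\<exists>x. y = sing x) \<or>
      (setcode y \<and> (\<forall>y'. cmem y' y \<longrightarrow> (\<exists>z'. E z' z \<and> rel w y' z')))"
      unfolding simulation_def by blast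
    ultimately show "(\<exists>x. y = sing x) \<or>
      (setcode y \<and> (\<forall>y'. cmem y' y \<longrightarrow> (\<exists>z'. E z' z \<and> rel (bigun c') y' z')))"
      using r by metis
  qed
  then show ?thesis using c r by blast
qed

text \<open>
  The set \<open>{z. \<Theta> z}\<close> below is \<open>\<Sigma>\<^sub>1\<close> and contains every \<open>z\<close> outside the well-founded part, so by
  foundation it meets the well-founded part.
\<close>

lemma collection_coded:
  assumes R: "sigma (ext (ext constants)) (\<lambda>p. R (snd (fst p)) (snd p))"
    and ex: "\<And>x. cmem x a \<Longrightarrow> \<exists>y. coded y \<and> R x y"
  shows "\<exists>c. coded c \<and> setcode c \<and> (\<forall>x. cmem x a \<longrightarrow> (\<exists>y. cmem y c \<and> R x y))"
proof -
  define \<Theta> where "\<Theta> z \<longleftrightarrow> (\<exists>r. simulation r \<and>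
    (\<forall>x. E x a \<longrightarrow> \<not> cmem x a \<or> (\<exists>y z'. (E z' z \<and> rel r y z') \<and> R x y)))" for z
  have \<Theta>: "sigma (ext constants) (\<lambda>p. \<Theta> (snd p))" unfolding \<Theta>_def
    by (intro sigma_disj sigma_conj sigma_ex sigma_ball sigma_dfn[OF dfn_not] sigma_dfn dfn_cmem dfn_simulation
        dfn_conj dfn_rel dfn_mem ext_snd ext_fst UNIV_I sigma_binary[OF R])
  have \<Theta>I: "\<Theta> z" if "simulation r" "\<forall>x. cmem x a \<longrightarrow> (\<exists>y z'. E z' z \<and> rel r y z' \<and> R x y)" for r z
    unfolding \<Theta>_def using that by blast
  have "\<exists>z. Wellfounded.accp E z \<and> \<Theta> z"
  proof (cases "\<forall>z. Wellfounded.accp E z")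
    case True
    have "\<exists>r. simulation r \<and> (\<forall>x. cmem x a \<longrightarrow> (\<exists>y z. True \<and> rel r y z \<and> R x y))"
    proof (rule simulations_union[OF R])
      show "dfn True (ext constants) (\<lambda>p. True)" by (rule dfn_const) (auto simp: ext_def)
      fix x
      assume "cmem x a"
      then obtain y where y: "coded y" "R x y" using ex by blast
      have "\<exists>r. simulation r \<and> rel r y y"
        by (rule simulation_exists[where B = "(=)"]) (use y in \<open>auto simp: cmem_def\<close>)
      then show "\<exists>r y z. simulation r \<and> rel r y z \<and> True \<and> R x y" using y by blast
    qed
    then obtain r where "simulation r" "\<forall>x. cmem x a \<longrightarrow> (\<exists>y z. rel r y z \<and> R x y)" by blast
    \<comment> \<open>The double union of \<open>r\<close> contains both coordinates of all its
      pairs, hence all ranks that occur.\<close>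
    then have "\<Theta> (bigun (bigun r))" by (intro \<Theta>I) (auto intro: rel_bigun simp del: E_bigun, metis rel_bigun(2))
    then show ?thesis using True by blast
  next
    case False
    have nonacc: "\<exists>z'. E z' z \<and> \<not> Wellfounded.accp E z'" if "\<not> Wellfounded.accp E z" for z
      using that by (metis Wellfounded.accp.accI)
    have all: "\<Theta> z" if z: "\<not> Wellfounded.accp E z" for z
    proof -
      have "\<exists>r. simulation r \<and> (\<forall>x. cmem x a \<longrightarrow> (\<exists>y z'. E z' z \<and> rel r y z' \<and> R x y))"
      proof (rule simulations_union[OF R])
        show "dfn True (ext constants) (\<lambda>p. E (snd p) z)" by (intro dfn_mem ext_snd ext_fst UNIV_I)
        fix x
        assume "cmem x a"
        then obtain y where y: "coded y" "R x y" using ex by blast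
        obtain z' where z': "E z' z" "\<not> Wellfounded.accp E z'" using nonacc[OF z] by blast
        have "\<exists>r. simulation r \<and> rel r y z'"
          by (rule simulation_exists[where B = "\<lambda>y z. \<not> Wellfounded.accp E z"]) (use y z' nonacc in auto)
        then show "\<exists>r y z'. simulation r \<and> rel r y z' \<and> E z' z \<and> R x y" using y z' by blast
      qed
      then show ?thesis using \<Theta>I by blast
    qed
    \<comment> \<open>An ill-founded \<open>z\<close> would have an ill-founded element, which
      satisfies \<Theta>; so a minimal \<open>z\<close> lies in the well-founded part.\<close>
    then obtain z where "\<Theta> z" "\<forall>x. E x z \<longrightarrow> \<not> \<Theta> x" using foundation_sigma[OF \<Theta>] False by blast
    then show ?thesis using all nonacc by blast
  qed
  then obtain z r where z: "Wellfounded.accp E z" and r: "simulation r"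
    "\<And>x. cmem x a \<Longrightarrow> \<exists>y z'. E z' z \<and> rel r y z' \<and> R x y"
    unfolding \<Theta>_def cmem_def by blast
  \<comment> \<open>Only those \<open>y\<close> are kept that are simulated by an element of the
    well-founded \<open>z\<close>, which makes them codes; elsewhere \<open>r\<close> may relate
    ill-founded ones.\<close>
  have "dfn True (ext constants) (\<lambda>p. \<exists>z'. E z' z \<and> rel r (snd p) z')"
    by (intro dfn_bex dfn_rel ext_snd ext_fst UNIV_I)
  from separation_dfn[OF this, of "bigun (bigun r)"] obtain c where
    "\<forall>y. E y c \<longleftrightarrow> E y (bigun (bigun r)) \<and> (\<exists>z'. E z' z \<and> rel r y z')" by blast
  then have c: "E y c \<longleftrightarrow> (\<exists>z'. E z' z \<and> rel r y z')" for y using rel_bigun(1) by blast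
  have coded: "coded y" if "E y c" for y
    using that simulation_coded[OF r(1)] z unfolding c by (metis accp_downward)
  show ?thesis
  proof (rule exI[of _ "mkset c"], intro conjI allI impI)
    show "coded (mkset c)" by (rule coded.set) (auto intro: coded)
    show "setcode (mkset c)" by simp
    fix x
    assume "cmem x a"
    then obtain y where "E y c" "R x y" using r(2) unfolding c by blast
    then show "\<exists>y. cmem y (mkset c) \<and> R x y" using coded[of y] by (metis cmem_mkset not_coded)
  qed
qed

end

section \<open>The cover\<close>

lemma foundation_wf:
  assumes "wf {(x, y). m x y}" shows "foundation D m S \<Gamma>"
  unfolding foundation_def
proof (intro ballI allI impI)
  fix \<phi> s i
  assume "\<exists>x\<in>D. S \<phi> (s(i := x))"
  then obtain x where "x \<in> {x \<in> D. S \<phi> (s(i := x))}" by blast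
  then show "\<exists>y\<in>D. S \<phi> (s(i := y)) \<and> (\<forall>x\<in>D. m x y \<longrightarrow> \<not> S \<phi> (s(i := x)))"
    by (rule wfE_min[OF assms]) auto
qed

context model
begin

definition cover :: "('f \<Rightarrow> ('m, 'k) V \<Rightarrow> ('m, 'k) V) \<Rightarrow> ('f, ('m, 'k) V) astruct" where
  "cover h = \<lparr>dmn = obj ` Collect coded, urs = range Ur,
    erel = (\<lambda>x y. \<exists>p q. x = Ur p \<and> y = Ur q \<and> E p q),
    mem = (\<lambda>x y. x \<in> obj ` Collect coded \<and> y \<in> obj ` Collect coded \<and> vmem x y), fn = h\<rparr>"

lemma cover_simps [simp]:
  "dmn (cover h) = obj ` Collect coded" "urs (cover h) = range Ur"
  "erel (cover h) x y \<longleftrightarrow> (\<exists>p q. x = Ur p \<and> y = Ur q \<and> E p q)"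
  "fn (cover h) = h"
  by (simp_all add: cover_def)

lemma range_Ur_coded: "range (Ur :: 'm \<Rightarrow> ('m, 'k) V) \<subseteq> obj ` Collect coded"
proof
  fix x :: "('m, 'k) V" assume "x \<in> range Ur"
  then obtain p where "x = obj (sing p)" by auto
  then show "x \<in> obj ` Collect coded" using coded.ur by blast
qed

lemma asets_cover: "asets (cover h) = obj ` {z. coded z \<and> setcode z}"
  unfolding asets_def using obj_setcode by auto

lemma mem_cover_obj [simp]:
  fixes h :: "'f \<Rightarrow> ('m, 'k) V \<Rightarrow> ('m, 'k) V"
  assumes "coded y" "coded z"
  shows "mem (cover h) (obj y) (obj z) \<longleftrightarrow> cmem y z"
proof -
  have "mem (cover h) (obj y) (obj z) \<longleftrightarrow> vmem (obj y) (obj z :: ('m, 'k) V)"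
    using assms by (simp add: cover_def)
  also have "\<dots> \<longleftrightarrow> cmem y z"
    unfolding vmem_obj[OF assms(2)] using obj_inject[OF assms(1)] coded_cmem[OF assms(2)] by metis
  finally show ?thesis .
qed

lemma obj_in_range_Ur: "coded z \<Longrightarrow> obj z \<in> range Ur \<longleftrightarrow> z \<in> range sing"
  using obj_setcode coded_sing_iff by blast

lemma standard_over_cover: "standard_over E (cover h)"
  unfolding standard_over_def
proof (intro conjI)
  show "\<forall>y\<in>dmn (cover h). \<forall>x. vmem x y \<longrightarrow> x \<in> dmn (cover h)"
    using coded_cmem by (fastforce simp: vmem_obj)
qed (use range_Ur_coded in \<open>auto simp: cover_def\<close>)

lemma wf_cover: "wf {(x, y). mem (cover h) x y}"
  by (rule wf_subset[OF wf_vmem]) (auto simp: cover_def)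

end

context coded_functions
begin

context
  fixes h :: "'f \<Rightarrow> ('m, 'k) V \<Rightarrow> ('m, 'k) V"
  assumes h: "\<And>f z. coded z \<Longrightarrow> h f (obj z) = obj (G f z)"
begin

lemma val_cover:
  assumes "\<And>i. coded (s i)"
  shows "coded (val (codes G) s t) \<and> val (cover h) (\<lambda>i. obj (s i)) t = obj (val (codes G) s t)"
  by (induction t) (auto simp: assms h coded_G)

text \<open>Absoluteness: a bounded quantifier at well-founded arguments ranges in both structures
  over the elements of a well-founded code, and these are themselves well-founded codes.\<close>

lemma sat_cover:
  assumes "\<phi> \<in> Delta0" "\<And>i. coded (s i)"
  shows "sat (cover h) \<phi> (\<lambda>i. obj (s i)) \<longleftrightarrow> sat (codes G) \<phi> s"
  using assms
proof (induction arbitrary: s)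
  case (1 t u)
  then show ?case using val_cover[of s t] val_cover[of s u] by simp
next
  case (2 t u)
  then show ?case using val_cover[of s t] val_cover[of s u] by (simp add: obj_inject)
next
  case (3 t u)
  have *: "obj z = Ur p \<longleftrightarrow> z = sing p" if "coded z" for z p
    using obj_inject[OF that coded.ur, of p] by simp
  show ?case using val_cover[of s t] val_cover[of s u] 3 by (simp add: *)
next
  case (4 t)
  then show ?case using val_cover[of s t] by (simp add: obj_in_range_Ur)
next
  case (5 \<phi>)
  then show ?case by simp
next
  case (6 \<phi> \<psi>)
  then show ?case by simp
next
  case (7 x t \<phi>)
  have upd: "(\<lambda>i. obj (s i))(x := obj y) = (\<lambda>i. obj ((s(x := y)) i))" for y by auto
  have *: "sat (cover h) (And (Mem (Var x) t) \<phi>) ((\<lambda>i. obj (s i))(x := obj y)) \<longleftrightarrow>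
      sat (codes G) (And (Mem (Var x) t) \<phi>) (s(x := y))" if "coded y" for y
  proof -
    define s' where "s' = s(x := y)"
    have c: "coded (s' i)" for i using 7 that by (simp add: s'_def)
    have "s' x = y" by (simp add: s'_def)
    then show ?thesis unfolding upd s'_def[symmetric] using 7(3)[of s', OF c] val_cover[of s' t, OF c] c[of x]
      by simp
  qed
  have "sat (cover h) (Exi x (And (Mem (Var x) t) \<phi>)) (\<lambda>i. obj (s i)) \<longleftrightarrow>
      (\<exists>y. coded y \<and> sat (codes G) (And (Mem (Var x) t) \<phi>) (s(x := y)))"
    using * by (auto simp del: sat.simps(6))
  moreover have "coded y" if "sat (codes G) (And (Mem (Var x) t) \<phi>) (s(x := y))" for y
    using that val_codes_cong[OF 7(1)] val_cover[of s t] 7(4) coded_cmem by auto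
  ultimately show ?case by auto
qed

lemma assignment_cover:
  fixes s :: "nat \<Rightarrow> ('m, 'k) V"
  assumes "range s \<subseteq> dmn (cover h)"
  obtains s' where "\<And>i. coded (s' i)" "s = (\<lambda>i. obj (s' i))"
proof -
  have "\<forall>i. \<exists>z. coded z \<and> s i = obj z" using assms by auto
  then obtain s' where s': "\<forall>i. coded (s' i) \<and> s i = obj (s' i)" by metis
  show thesis by (rule that[of s']) (use s' in auto)
qed

lemma Schemes_cover: "Schemes (cover h)"
  unfolding Schemes_def
proof (intro conjI)
  show "foundation (dmn (cover h)) (mem (cover h)) (sat (cover h)) Pi1"
    by (rule foundation_wf) (rule wf_cover)
  show "separation (dmn (cover h)) (asets (cover h)) (mem (cover h)) (sat (cover h)) Delta0"
    unfolding separation_def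
  proof (intro ballI allI impI)
    fix \<phi> :: "'f fm" and s :: "nat \<Rightarrow> ('m, 'k) V" and i a
    assume \<phi>: "\<phi> \<in> Delta0" and s: "range s \<subseteq> dmn (cover h)" and a: "a \<in> asets (cover h)"
    obtain s' where s': "\<And>i. coded (s' i)" "s = (\<lambda>i. obj (s' i))" by (rule assignment_cover[OF s]) blast
    obtain z where z: "a = obj z" "coded z" "setcode z" using a unfolding asets_cover by blast
    let ?R = "\<lambda>y. sat (codes G) \<phi> (s'(i := y))"
    have sub: "(\<lambda>p. f (s'(i := snd p))) \<in> ext constants" if "f \<in> projections" for f :: "(nat \<Rightarrow> 'm) \<Rightarrow> 'm"
      using that
    proof (rule projections_subst)
      show "(\<lambda>p. (s'(i := snd p)) j) \<in> ext constants" for j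
        by (cases "j = i") (auto intro: ext_snd ext_fst)
    qed (rule ext_fst, simp)
    have "sigma (ext constants) (\<lambda>p. ?R (snd p))" "sigma (ext constants) (\<lambda>p. \<not> ?R (snd p))"
      by (rule sigma_subst[OF conjunct1[OF sigma_sat[OF \<phi>]]], erule sub,
          rule sigma_subst[OF conjunct2[OF sigma_sat[OF \<phi>]]], erule sub)
    then obtain b where b: "\<forall>y. E y b \<longleftrightarrow> E y z \<and> ?R y"
      using separation_delta[of ?R z] by blast
    \<comment> \<open>Separation tests the markers too and may drop them; \<open>mkset\<close>
      restores them.\<close>
    have b': "cmem y (mkset b) \<longleftrightarrow> cmem y z \<and> ?R y" for y
      using b z(3) by (auto simp: cmem_def[of y z])
    have cb: "coded (mkset b)" by (rule coded.set) (use b' coded_cmem[OF z(2)] in auto)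
    have "mem (cover h) x (obj (mkset b)) \<longleftrightarrow> mem (cover h) x a \<and> sat (cover h) \<phi> (s(i := x))"
      if x: "x \<in> dmn (cover h)" for x
    proof -
      obtain y where y: "x = obj y" "coded y" using x by auto
      have "s(i := x) = (\<lambda>j. obj ((s'(i := y)) j))" using s'(2) y(1) by auto
      then have "sat (cover h) \<phi> (s(i := x)) \<longleftrightarrow> ?R y"
        using sat_cover[OF \<phi>, of "s'(i := y)"] s'(1) y(2) by simp
      then show ?thesis using b' y z cb by simp
    qed
    then show "\<exists>b\<in>asets (cover h). \<forall>x\<in>dmn (cover h).
        mem (cover h) x b \<longleftrightarrow> mem (cover h) x a \<and> sat (cover h) \<phi> (s(i := x))"
      using cb by (intro bexI[of _ "obj (mkset b)"]) (auto simp: asets_cover)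
  qed
  show "collection (dmn (cover h)) (asets (cover h)) (mem (cover h)) (sat (cover h)) Delta0"
    unfolding collection_def
  proof (intro ballI allI impI)
    fix \<phi> :: "'f fm" and s :: "nat \<Rightarrow> ('m, 'k) V" and i j a
    assume \<phi>: "\<phi> \<in> Delta0" and s: "range s \<subseteq> dmn (cover h)" and "i \<noteq> j"
      and a: "a \<in> asets (cover h)"
      and ex: "\<forall>x\<in>dmn (cover h). mem (cover h) x a \<longrightarrow>
        (\<exists>y\<in>dmn (cover h). sat (cover h) \<phi> (s(i := x, j := y)))"
    obtain s' where s': "\<And>i. coded (s' i)" "s = (\<lambda>i. obj (s' i))" by (rule assignment_cover[OF s]) blast
    obtain z where z: "a = obj z" "coded z" "setcode z" using a unfolding asets_cover by blast
    let ?R = "\<lambda>x y. sat (codes G) \<phi> (s'(i := x, j := y))"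
    have sub: "(\<lambda>p. f (s'(i := snd (fst p), j := snd p))) \<in> ext (ext constants)"
      if "f \<in> projections" for f :: "(nat \<Rightarrow> 'm) \<Rightarrow> 'm"
      using that
    proof (rule projections_subst)
      show "(\<lambda>p. (s'(i := snd (fst p), j := snd p)) l) \<in> ext (ext constants)" for l
        by (cases "l = i"; cases "l = j") (auto intro!: ext_snd ext_fst)
    qed (rule ext_fst, rule ext_fst, simp)
    have sat: "sat (cover h) \<phi> (s(i := obj x, j := obj y)) \<longleftrightarrow> ?R x y" if "coded x" "coded y" for x y
    proof -
      have "s(i := obj x, j := obj y) = (\<lambda>l. obj ((s'(i := x, j := y)) l))" using s'(2) by auto
      then show ?thesis using sat_cover[OF \<phi>, of "s'(i := x, j := y)"] s'(1) that by simp
    qed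
    have "\<exists>c. coded c \<and> setcode c \<and> (\<forall>x. cmem x z \<longrightarrow> (\<exists>y. cmem y c \<and> ?R x y))"
    proof (rule collection_coded)
      show "sigma (ext (ext constants)) (\<lambda>p. ?R (snd (fst p)) (snd p))"
        by (rule sigma_subst[OF conjunct1[OF sigma_sat[OF \<phi>]] sub])
      fix x
      assume x: "cmem x z"
      then have "coded x" using coded_cmem z(2) by blast
      then obtain v where "v \<in> dmn (cover h)" "sat (cover h) \<phi> (s(i := obj x, j := v))"
        using ex[rule_format, of "obj x"] x z by auto
      then show "\<exists>y. coded y \<and> ?R x y" using sat[OF \<open>coded x\<close>] by auto
    qed
    then obtain c where c: "coded c" "setcode c" "\<And>x. cmem x z \<Longrightarrow> \<exists>y. cmem y c \<and> ?R x y" by blast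
    show "\<exists>c\<in>asets (cover h). \<forall>x\<in>dmn (cover h). mem (cover h) x a \<longrightarrow>
        (\<exists>y\<in>dmn (cover h). mem (cover h) y c \<and> sat (cover h) \<phi> (s(i := x, j := y)))"
    proof (rule bexI[of _ "obj c"], intro ballI impI)
      fix v
      assume "v \<in> dmn (cover h)" "mem (cover h) v a"
      then obtain x where x: "v = obj x" "coded x" "cmem x z" using z by auto
      then obtain y where y: "cmem y c" "?R x y" using c(3) by blast
      then have "coded y" using coded_cmem c(1) by blast
      then show "\<exists>y\<in>dmn (cover h). mem (cover h) y (obj c) \<and> sat (cover h) \<phi> (s(i := v, j := y))"
        using x y c(1) sat[of x y] by auto
    qed (use c in \<open>auto simp: asets_cover\<close>)
  qed
qed

lemma is_structure_cover: "is_structure (cover h)"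
  unfolding is_structure_def
proof (intro conjI)
  show "dmn (cover h) \<noteq> {}" using coded.ur by auto
  show "urs (cover h) \<subseteq> dmn (cover h)" using range_Ur_coded by simp
  show "\<forall>x y. mem (cover h) x y \<longrightarrow> x \<in> dmn (cover h) \<and> y \<in> asets (cover h)"
    by (auto simp: asets_def) (auto simp: cover_def)
  show "\<forall>f. \<forall>x\<in>dmn (cover h). fn (cover h) f x \<in> dmn (cover h)"
    using h coded_G by auto
qed auto

end
end

section \<open>The axioms in the covers for both languages\<close>

lemma (in model) F_of_obj:
  assumes "coded z" shows "F_of E (obj z) = (obj (F_code z) :: ('m, 'k) V)"
proof (rule V_extensionality)
  show "F_of E (obj z) \<notin> range (Ur :: 'm \<Rightarrow> ('m, 'k) V)" by (rule F_of)
  show "obj (F_code z) \<notin> range (Ur :: 'm \<Rightarrow> ('m, 'k) V)" by (simp add: obj_setcode coded_F_code)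
  have *: "obj z = (Ur p :: ('m, 'k) V) \<longleftrightarrow> z = sing p" for p
    using obj_inject[OF assms coded.ur, of p] by simp
  have "vmem x (obj (F_code z)) \<longleftrightarrow> (\<exists>p q. z = sing q \<and> E p q \<and> x = obj (sing p))" for x :: "('m, 'k) V"
    unfolding vmem_obj[OF coded_F_code] cmem_F_code by blast
  then show "vmem x (F_of E (obj z)) \<longleftrightarrow> vmem x (obj (F_code z))" for x :: "('m, 'k) V"
    by (auto simp: F_of *)
qed

sublocale model \<subseteq> cov: coded_functions E "\<lambda>_ :: fsym. F_code"
  by unfold_locales (auto intro: F_code_dfn coded_F_code)

sublocale model \<subseteq> covP: coded_functions E "case_fsymP (\<lambda>_. F_code) P_code"
proof
  show "dfn True (ext (ext constants)) (\<lambda>p. snd p = case_fsymP (\<lambda>_. F_code) P_code f (snd (fst p)))" for f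
    by (cases f) (auto intro: F_code_dfn P_code_dfn)
  show "coded (case_fsymP (\<lambda>_. F_code) P_code f z)" if "coded z" for f z
    using that by (cases f) (auto intro: coded_F_code coded_P_code)
qed

context model
begin

definition cov :: "(fsym, ('m, 'k) V) astruct" where "cov = cover (\<lambda>_. F_of E)"

lemma KPU_Cov_cov: "KPU_Cov (cov :: (fsym, ('m, 'k) V) astruct)"
  unfolding KPU_Cov_def
proof (intro conjI)
  let ?A = "cov :: (fsym, ('m, 'k) V) astruct"
  have c0: "coded (mkset zero)" by (rule coded.set) auto
  show "asets ?A \<noteq> {}" unfolding cov_def asets_cover using c0 by auto
  show "\<forall>p\<in>urs ?A. \<forall>x\<in>dmn ?A. \<not> mem ?A x p" by (auto simp: cov_def) (simp add: cover_def)
  show "\<forall>a\<in>asets ?A. \<forall>b\<in>asets ?A. (\<forall>x\<in>dmn ?A. mem ?A x a \<longleftrightarrow> mem ?A x b) \<longrightarrow> a = b"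
  proof (intro ballI impI)
    fix a b
    assume "a \<in> asets ?A" "b \<in> asets ?A" and eq: "\<forall>x\<in>dmn ?A. mem ?A x a \<longleftrightarrow> mem ?A x b"
    then obtain y z where yz: "a = obj y" "b = obj z" "coded y" "coded z" "setcode y" "setcode z"
      unfolding cov_def asets_cover by blast
    have "cmem x y \<longleftrightarrow> cmem x z" for x
      using eq yz coded_cmem[of y x] coded_cmem[of z x] by (auto simp: cov_def)
    then show "a = b" using setcode_ext yz by blast
  qed
  show "\<forall>x\<in>dmn ?A. \<forall>y\<in>dmn ?A. \<exists>a\<in>asets ?A. \<forall>z\<in>dmn ?A. mem ?A z a \<longleftrightarrow> z = x \<or> z = y"
  proof (intro ballI)
    fix x y
    assume "x \<in> dmn ?A" "y \<in> dmn ?A"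
    then obtain u v where uv: "x = obj u" "y = obj v" "coded u" "coded v" by (auto simp: cov_def)
    then have c: "coded (mkset (upair u v))" by (intro coded.set[OF setcode_mkset]) auto
    have "u \<noteq> zero" "u \<noteq> two" "v \<noteq> zero" "v \<noteq> two" using uv by auto
    then show "\<exists>a\<in>asets ?A. \<forall>z\<in>dmn ?A. mem ?A z a \<longleftrightarrow> z = x \<or> z = y"
      using c uv by (intro bexI[of _ "obj (mkset (upair u v))"]) (auto simp: cov_def asets_cover obj_inject)
  qed
  show "\<forall>a\<in>asets ?A. \<exists>b\<in>asets ?A. \<forall>y\<in>dmn ?A. mem ?A y a \<longrightarrow>
      (\<forall>x\<in>dmn ?A. mem ?A x y \<longrightarrow> mem ?A x b)"
  proof
    fix a
    assume "a \<in> asets ?A"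
    then obtain z where z: "a = obj z" "coded z" "setcode z" unfolding cov_def asets_cover by blast
    have "dfn True (ext constants) (\<lambda>p. \<exists>y. E y z \<and> cmem y z \<and> cmem (snd p) y)"
      by (intro dfn_bex dfn_conj dfn_cmem ext_snd ext_fst UNIV_I)
    from separation_dfn[OF this, of "bigun z"] obtain b where
      "\<forall>x. E x b \<longleftrightarrow> E x (bigun z) \<and> (\<exists>y. E y z \<and> cmem y z \<and> cmem x y)" by blast
    then have b: "E x b \<longleftrightarrow> (\<exists>y. cmem y z \<and> cmem x y)" for x by (auto simp: cmem_def)
    have c: "coded (mkset b)"
      by (rule coded.set) (use b coded_cmem z(2) in \<open>auto intro: coded_cmem\<close>)
    show "\<exists>b\<in>asets ?A. \<forall>y\<in>dmn ?A. mem ?A y a \<longrightarrow> (\<forall>x\<in>dmn ?A. mem ?A x y \<longrightarrow> mem ?A x b)"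
      using c z by (intro bexI[of _ "obj (mkset b)"]) (auto simp: cov_def asets_cover b cmem_def[of zero] cmem_def[of two])
  qed
  show "Schemes ?A" unfolding cov_def by (rule cov.Schemes_cover) (rule F_of_obj)
  show "\<forall>p\<in>urs ?A. \<forall>x\<in>dmn ?A. erel ?A x p \<longleftrightarrow> mem ?A x (fn ?A F_sym p)"
  proof (intro ballI)
    fix p x assume "p \<in> urs ?A" "x \<in> dmn ?A"
    moreover from this have "p \<in> obj ` Collect coded" using range_Ur_coded by (auto simp: cov_def)
    then have "F_of E p \<in> obj ` Collect coded" using F_of_obj coded_F_code by auto
    ultimately show "erel ?A x p \<longleftrightarrow> mem ?A x (fn ?A F_sym p)"
      by (simp add: cov_def) (auto simp: cover_def F_of)
  qed
  show "\<forall>a\<in>asets ?A. fn ?A F_sym a \<in> asets ?A \<and> (\<forall>x\<in>dmn ?A. \<not> mem ?A x (fn ?A F_sym a))"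
  proof (intro ballI conjI)
    fix a assume a: "a \<in> asets ?A"
    then obtain z where z: "a = obj z" "coded z" unfolding cov_def asets_cover by blast
    then have "F_of E a \<in> obj ` {z. coded z \<and> setcode z}"
      unfolding z(1) F_of_obj[OF z(2)] using coded_F_code by auto
    then show "fn ?A F_sym a \<in> asets ?A" by (simp add: cov_def asets_cover)
    show "\<not> mem ?A x (fn ?A F_sym a)" for x
      using a by (auto simp: cov_def cover_def asets_def F_of)
  qed
qed

lemma admissible_cov: "admissible cov"
  unfolding admissible_def
  using KPU_Cov_cov wf_cover cov.is_structure_cover[of "\<lambda>_. F_of E"] F_of_obj by (auto simp: cov_def)

text \<open>Collects those subsets that \<M> can code, which are exactly the ones in the
  cover.\<close>

definition P_of :: "('m, 'k) V \<Rightarrow> ('m, 'k) V" where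
  "P_of v = obj (P_code (inv_into (Collect coded) obj v))"

lemma P_of_obj: "coded z \<Longrightarrow> P_of (obj z) = obj (P_code z)"
  unfolding P_of_def by (subst inv_into_f_f) (auto intro!: inj_onI simp: obj_inject)

lemma expand_cov: "expand cov P_of = cover (case_fsymP (\<lambda>_. F_of E) P_of)"
  by (simp add: expand_def cov_def cover_def)

lemma power_admissible_cov: "power_admissible (expand cov P_of :: (fsymP, ('m, 'k) V) astruct)"
proof -
  let ?B = "expand cov P_of :: (fsymP, ('m, 'k) V) astruct"
  have h: "case_fsymP (\<lambda>_. F_of E) P_of f (obj z) = obj (case_fsymP (\<lambda>_. F_code) P_code f z)"
    if "coded z" for f z
    using that by (cases f) (auto simp: F_of_obj P_of_obj)
  have "Schemes ?B" "is_structure ?B"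
    unfolding expand_cov by (rule covP.Schemes_cover[OF h] covP.is_structure_cover[OF h]; assumption)+
  moreover have "mem ?B b (fn ?B P_sym a) \<longleftrightarrow> (\<forall>x\<in>dmn ?B. mem ?B x b \<longrightarrow> mem ?B x a)"
    if ab: "a \<in> asets ?B" "b \<in> asets ?B" for a b
  proof -
    obtain y z where yz: "a = obj y" "b = obj z" "coded y" "coded z" "setcode y" "setcode z"
      using ab unfolding expand_cov asets_cover by blast
    have "mem ?B b (fn ?B P_sym a) \<longleftrightarrow> (\<forall>v. E v z \<longrightarrow> E v y)"
      using yz by (simp add: expand_cov P_of_obj coded_P_code)
    also have "\<dots> \<longleftrightarrow> (\<forall>v. cmem v z \<longrightarrow> cmem v y)"
      using yz unfolding cmem_def setcode_def by metis
    also have "\<dots> \<longleftrightarrow> (\<forall>x\<in>dmn ?B. mem ?B x b \<longrightarrow> mem ?B x a)"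
      using yz coded_cmem[of z] by (auto simp: expand_cov)
    finally show ?thesis .
  qed
  moreover have "KPU_Cov (reduct ?B)" by (simp add: KPU_Cov_cov)
  moreover have "wf {(x, y). mem ?B x y}" unfolding expand_cov by (rule wf_cover)
  ultimately show ?thesis unfolding power_admissible_def KPUP_Cov_def by blast
qed

end

section \<open>Minimality\<close>

definition bex :: "nat \<Rightarrow> 'f trm \<Rightarrow> 'f fm \<Rightarrow> 'f fm" where
  "bex x t \<phi> = Exi x (And (Mem (Var x) t) \<phi>)"

definition ball :: "nat \<Rightarrow> 'f trm \<Rightarrow> 'f fm \<Rightarrow> 'f fm" where
  "ball x t \<phi> = Neg (bex x t (Neg \<phi>))"

definition Disj :: "'f fm \<Rightarrow> 'f fm \<Rightarrow> 'f fm" where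
  "Disj \<phi> \<psi> = Neg (And (Neg \<phi>) (Neg \<psi>))"

lemma Delta0_bex: "x \<notin> vars t \<Longrightarrow> \<phi> \<in> Delta0 \<Longrightarrow> bex x t \<phi> \<in> Delta0"
  unfolding bex_def by (rule Delta0.intros)

lemma Delta0_ball: "x \<notin> vars t \<Longrightarrow> \<phi> \<in> Delta0 \<Longrightarrow> ball x t \<phi> \<in> Delta0"
  unfolding ball_def by (intro Delta0.intros Delta0_bex)

lemma Delta0_Disj: "\<phi> \<in> Delta0 \<Longrightarrow> \<psi> \<in> Delta0 \<Longrightarrow> Disj \<phi> \<psi> \<in> Delta0"
  unfolding Disj_def by (intro Delta0.intros)

lemmas Delta0_intros = Delta0.intros(1-6) Delta0_bex Delta0_ball Delta0_Disj

lemma sat_Disj [simp]: "sat \<AA> (Disj \<phi> \<psi>) s \<longleftrightarrow> sat \<AA> \<phi> s \<or> sat \<AA> \<psi> s"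
  by (simp add: Disj_def)

locale admissible_over = model E for E :: "'m \<Rightarrow> 'm \<Rightarrow> bool" +
  fixes \<AA> :: "(fsym, ('m, 'k) V) astruct"
  assumes std: "standard_over E \<AA>" and adm: "admissible \<AA>"
begin

abbreviation "m \<equiv> mem \<AA>"
abbreviation "F \<equiv> fn \<AA> F_sym"

lemma dmn_vmem: "y \<in> dmn \<AA> \<Longrightarrow> vmem x y \<Longrightarrow> x \<in> dmn \<AA>"
  using std unfolding standard_over_def by blast

lemma m_iff: "m x y \<longleftrightarrow> y \<in> dmn \<AA> \<and> vmem x y"
  using std dmn_vmem unfolding standard_over_def by auto

lemma m_dmn: "m x y \<Longrightarrow> x \<in> dmn \<AA>"
  using m_iff dmn_vmem by blast

lemma urs_eq [simp]: "urs \<AA> = range Ur"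
  using std unfolding standard_over_def by blast

lemma Ur_dmn [simp]: "Ur p \<in> dmn \<AA>"
  using std unfolding standard_over_def by blast

lemma asets_iff: "a \<in> asets \<AA> \<longleftrightarrow> a \<in> dmn \<AA> \<and> a \<notin> range Ur"
  by (simp add: asets_def)

lemma KPU: "KPU_Cov \<AA>"
  using adm by (simp add: admissible_def)

lemma m_F_Ur [simp]: "m x (F (Ur p)) \<longleftrightarrow> (\<exists>q. x = Ur q \<and> E q p)"
proof -
  have "\<forall>p\<in>urs \<AA>. \<forall>x\<in>dmn \<AA>. erel \<AA> x p \<longleftrightarrow> m x (F p)" using KPU unfolding KPU_Cov_def by blast
  then have "x \<in> dmn \<AA> \<Longrightarrow> erel \<AA> x (Ur p) \<longleftrightarrow> m x (F (Ur p))" by simp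
  moreover have "erel \<AA> x (Ur p) \<longleftrightarrow> (\<exists>q. x = Ur q \<and> E q p)"
    using std unfolding standard_over_def by auto
  ultimately show ?thesis using m_dmn by auto
qed

section \<open>The axioms inside an arbitrary admissible set covering \<M>\<close>

lemma separationA:
  assumes "\<phi> \<in> Delta0" "\<And>i. s i \<in> dmn \<AA>" "a \<in> asets \<AA>"
  shows "\<exists>b\<in>asets \<AA>. \<forall>x. m x b \<longleftrightarrow> m x a \<and> sat \<AA> \<phi> (s(i := x))"
proof -
  have "separation (dmn \<AA>) (asets \<AA>) m (sat \<AA>) Delta0" using KPU unfolding KPU_Cov_def Schemes_def by blast
  moreover have "range s \<subseteq> dmn \<AA>" using assms(2) by auto
  ultimately have "\<exists>b\<in>asets \<AA>. \<forall>x\<in>dmn \<AA>. m x b \<longleftrightarrow> m x a \<and> sat \<AA> \<phi> (s(i := x))"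
    using assms(1,3) unfolding separation_def by simp
  then show ?thesis using m_dmn by blast
qed

lemma collectionA:
  assumes "\<phi> \<in> Delta0" "\<And>i. s i \<in> dmn \<AA>" "a \<in> asets \<AA>" "i \<noteq> j"
    and "\<And>x. m x a \<Longrightarrow> \<exists>y\<in>dmn \<AA>. sat \<AA> \<phi> (s(i := x, j := y))"
  shows "\<exists>c\<in>asets \<AA>. \<forall>x. m x a \<longrightarrow> (\<exists>y. m y c \<and> sat \<AA> \<phi> (s(i := x, j := y)))"
proof -
  have "collection (dmn \<AA>) (asets \<AA>) m (sat \<AA>) Delta0" using KPU unfolding KPU_Cov_def Schemes_def by blast
  moreover have "range s \<subseteq> dmn \<AA>" using assms(2) by auto
  ultimately have "\<exists>c\<in>asets \<AA>. \<forall>x\<in>dmn \<AA>. m x a \<longrightarrow> (\<exists>y\<in>dmn \<AA>. m y c \<and> sat \<AA> \<phi> (s(i := x, j := y)))"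
    using assms(1,3,4,5) unfolding collection_def by simp
  then show ?thesis using m_dmn by blast
qed

lemma pairA:
  assumes "x \<in> dmn \<AA>" "y \<in> dmn \<AA>"
  shows "\<exists>a\<in>asets \<AA>. \<forall>z. m z a \<longleftrightarrow> z = x \<or> z = y"
proof -
  have "\<exists>a\<in>asets \<AA>. \<forall>z\<in>dmn \<AA>. m z a \<longleftrightarrow> z = x \<or> z = y"
    using KPU assms unfolding KPU_Cov_def by blast
  then show ?thesis using m_dmn assms by blast
qed

lemma sat_bex [simp]:
  assumes "x \<notin> vars t"
  shows "sat \<AA> (bex x t \<phi>) s \<longleftrightarrow> (\<exists>v. m v (val \<AA> s t) \<and> sat \<AA> \<phi> (s(x := v)))"
proof -
  have "val \<AA> (s(x := v)) t = val \<AA> s t" for v using assms by (induction t) auto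
  then show ?thesis using m_dmn by (auto simp: bex_def)
qed

lemma sat_ball [simp]:
  assumes "x \<notin> vars t"
  shows "sat \<AA> (ball x t \<phi>) s \<longleftrightarrow> (\<forall>v. m v (val \<AA> s t) \<longrightarrow> sat \<AA> \<phi> (s(x := v)))"
  using assms by (simp add: ball_def)

text \<open>The Union axiom yields only a superset, which Separation cuts down.\<close>

lemma unionA:
  assumes "a \<in> asets \<AA>"
  shows "\<exists>b\<in>asets \<AA>. \<forall>x. m x b \<longleftrightarrow> (\<exists>y. m y a \<and> m x y)"
proof -
  have "\<forall>a\<in>asets \<AA>. \<exists>b\<in>asets \<AA>. \<forall>y\<in>dmn \<AA>. m y a \<longrightarrow> (\<forall>x\<in>dmn \<AA>. m x y \<longrightarrow> m x b)"
    using KPU unfolding KPU_Cov_def by blast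
  then obtain b where b: "b \<in> asets \<AA>" "\<forall>y\<in>dmn \<AA>. m y a \<longrightarrow> (\<forall>x\<in>dmn \<AA>. m x y \<longrightarrow> m x b)"
    using assms by blast
  let ?s = "(\<lambda>_. Ur undefined)(1 := a)"
  have "bex 2 (Var 1) (Mem (Var 0) (Var 2)) \<in> (Delta0 :: fsym fm set)" by (intro Delta0_intros) simp
  moreover have "?s i \<in> dmn \<AA>" for i using assms by (simp add: asets_iff)
  ultimately obtain c where "c \<in> asets \<AA>"
    "\<forall>x. m x c \<longleftrightarrow> m x b \<and> sat \<AA> (bex 2 (Var 1) (Mem (Var 0) (Var 2))) (?s(0 := x))"
    using separationA[where s = ?s and i = 0] b(1) by blast
  then show ?thesis using b(2) m_dmn by (intro bexI[of _ c]) auto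
qed

text \<open>
  A set \<open>r\<close> stands for the relation between urelements \<open>p\<close> and sets \<open>x\<close> lying in a common element
  of \<open>r\<close>; unordered pairs suffice because the two sides are of different kinds.  A decoding is a
  bisimulation of this kind between codes and the sets they code.
\<close>

definition decodes where
  "decodes r p x \<longleftrightarrow> (x \<in> range Ur \<and> m x (F p) \<and> (\<forall>q. m q (F p) \<longrightarrow> q = x)) \<or>
     (x \<notin> range Ur \<and> (\<exists>d. m d r \<and> m p d \<and> m x d))"

definition decoding where
  "decoding r \<longleftrightarrow> (\<forall>d. m d r \<longrightarrow> (\<forall>p. m p d \<longrightarrow> (\<forall>x. m x d \<longrightarrow> p \<in> range Ur \<and> x \<notin> range Ur \<longrightarrow>
     m (Ur zero) (F p) \<and> m (Ur two) (F p) \<and>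
     (\<forall>p'. m p' (F p) \<longrightarrow> p' = Ur zero \<or> p' = Ur two \<or> (\<exists>x'. m x' x \<and> decodes r p' x')) \<and>
     (\<forall>x'. m x' x \<longrightarrow> (\<exists>p'. m p' (F p) \<and> p' \<noteq> Ur zero \<and> p' \<noteq> Ur two \<and> decodes r p' x')))))"

abbreviation "FV x \<equiv> App F_sym (Var x)"

text \<open>Variable 20 is bound here, whence the side conditions below that keep the arguments
  smaller.\<close>

definition decodes_fm :: "nat \<Rightarrow> nat \<Rightarrow> nat \<Rightarrow> fsym fm" where
  "decodes_fm r p x =
     Disj (And (IsUr (Var x)) (And (Mem (Var x) (FV p)) (ball 20 (FV p) (Eq (Var 20) (Var x)))))
       (And (Neg (IsUr (Var x))) (bex 20 (Var r) (And (Mem (Var p) (Var 20)) (Mem (Var x) (Var 20)))))"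

lemma decodes_fm: "r < 20 \<Longrightarrow> p < 20 \<Longrightarrow> x < 20 \<Longrightarrow> decodes_fm r p x \<in> Delta0"
  unfolding decodes_fm_def by (intro Delta0_intros) auto

lemma sat_decodes_fm [simp]:
  "r < 20 \<Longrightarrow> p < 20 \<Longrightarrow> x < 20 \<Longrightarrow> sat \<AA> (decodes_fm r p x) s \<longleftrightarrow> decodes (s r) (s p) (s x)"
  unfolding decodes_fm_def decodes_def by auto

text \<open>The variables \<open>1\<close> and \<open>2\<close> hold \<open>zero\<close> and \<open>two\<close>.\<close>

definition decoding_fm :: "fsym fm" where
  "decoding_fm = ball 10 (Var 3) (ball 11 (Var 10) (ball 12 (Var 10)
     (Disj (Neg (And (IsUr (Var 11)) (Neg (IsUr (Var 12)))))
       (And (Mem (Var 1) (FV 11)) (And (Mem (Var 2) (FV 11)) (And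
         (ball 13 (FV 11) (Disj (Eq (Var 13) (Var 1)) (Disj (Eq (Var 13) (Var 2))
           (bex 14 (Var 12) (decodes_fm 3 13 14)))))
         (ball 14 (Var 12) (bex 13 (FV 11) (And (Neg (Eq (Var 13) (Var 1)))
           (And (Neg (Eq (Var 13) (Var 2))) (decodes_fm 3 13 14)))))))))))"

lemma decoding_fm: "decoding_fm \<in> Delta0"
  unfolding decoding_fm_def by (intro Delta0_intros decodes_fm) auto

lemma sat_decoding_fm [simp]:
  assumes "s 1 = Ur zero" "s 2 = Ur two"
  shows "sat \<AA> decoding_fm s \<longleftrightarrow> decoding (s 3)"
proof -
  have "(p \<in> range Ur \<and> x \<notin> range Ur \<longrightarrow> C) \<longleftrightarrow> (p \<in> range Ur \<longrightarrow> x \<in> range Ur \<or> C)"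
    for p x :: "('m, 'k) V" and C by blast
  with assms show ?thesis unfolding decoding_fm_def decoding_def by simp
qed

lemma decodes_ur: "decodes r (Ur p) (Ur q) \<longleftrightarrow> p = sing q"
proof -
  have "decodes r (Ur p) (Ur q) \<longleftrightarrow> E q p \<and> (\<forall>q'. E q' p \<longrightarrow> q' = q)"
    unfolding decodes_def by auto
  then show ?thesis unfolding sing_iff .
qed

text \<open>The induction is on \<open>x\<close>, whose membership is well-founded. Nothing is
  assumed about \<open>p\<close>; that it is a well-founded code comes out of the proof.\<close>

lemma decoding_den:
  assumes "decoding r" "m d r" "m (Ur p) d" "m x d" "x \<notin> range Ur"
  shows "den p x"
  using assms(2-)
proof (induction x arbitrary: p d rule: V_induct)
  case (1 x)
  have IH: "den p' x'" if "vmem x' x" "decodes r (Ur p') x'" for p' x'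
  proof (cases "x' \<in> range Ur")
    case True
    then obtain q where "x' = Ur q" by blast
    then show ?thesis using that(2) decodes_ur den.ur by metis
  next
    case False
    then show ?thesis using that 1(1) unfolding decodes_def by blast
  qed
  have x: "m x' x \<longleftrightarrow> vmem x' x" for x' using m_iff m_dmn[OF 1(4)] by blast
  note * = assms(1)[unfolded decoding_def, rule_format, OF 1(2-4), simplified x, OF conjI[OF rangeI 1(5)]]
  show ?case
  proof (rule den.set)
    show "setcode p" using * by (simp add: setcode_def)
    show "\<exists>x'. vmem x' x \<and> den y x'" if "cmem y p" for y
      using * that IH unfolding cmem_def by (metis Ur_inject m_F_Ur)
    show "\<exists>y. cmem y p \<and> den y x'" if "vmem x' x" for x'
      using * that IH \<open>setcode p\<close> unfolding cmem_def by (metis Ur_inject m_F_Ur)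
  qed (rule 1(5))
qed

lemma decodes_obj:
  assumes "decoding r" "decodes r (Ur p) x" shows "x = obj p"
proof -
  have "den p x"
  proof (cases "x \<in> range Ur")
    case True
    then obtain q where "x = Ur q" by blast
    then show ?thesis using assms(2) decodes_ur den.ur by metis
  next
    case False
    then show ?thesis using assms decoding_den unfolding decodes_def by blast
  qed
  then show ?thesis by (rule obj_eqI[symmetric])
qed

lemma decoding_mono:
  assumes "\<And>d. m d r \<Longrightarrow> m d r'" "decodes r p x" shows "decodes r' p x"
  using assms unfolding decodes_def by blast

text \<open>Recursion is replaced by an external induction on the code, each step of which needs
  just finitely many applications of the axioms. Decodings for the elements of \<open>z\<close>
  agree, being correct by \<open>decodes_obj\<close>, so they may be united and extended by one
  pair.\<close>

lemma decodes_exists: "coded z \<Longrightarrow> \<exists>r\<in>dmn \<AA>. \<exists>x\<in>dmn \<AA>. decoding r \<and> decodes r (Ur z) x"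
proof (induction rule: coded.induct)
  case (ur p)
  \<comment> \<open>An urelement has no elements, so it serves as the empty relation; codes of
    urelements are decoded without looking into \<open>r\<close>.\<close>
  have "decoding (Ur p)" by (simp add: decoding_def m_iff)
  then show ?case by (metis Ur_dmn decodes_ur)
next
  case (set z)
  let ?a = "F (Ur z)"
  have z: "E zero z" "E two z" using set.hyps by (auto simp: setcode_def)
  then have "m (Ur zero) ?a" by simp
  then have a: "?a \<in> asets \<AA>" unfolding asets_iff m_iff by auto
  define s :: "nat \<Rightarrow> ('m, 'k) V" where "s = (\<lambda>_. Ur zero)(2 := Ur two, 6 := Ur z)"
  have s: "s i \<in> dmn \<AA>" for i by (simp add: s_def)
  have s12: "s 1 = Ur zero" "s 2 = Ur two" "s 6 = Ur z" by (simp_all add: s_def)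
  \<comment> \<open>Collection needs a partner for every element of \<open>F (Ur z)\<close>. The
    formula therefore accepts anything for the two markers and for singletons, and otherwise asks
    for a decoding in which variable 4 occurs together with some set.\<close>
  define \<psi> :: "fsym fm" where "\<psi> = Disj (Eq (Var 4) (Var 1)) (Disj (Eq (Var 4) (Var 2))
    (Disj (bex 5 (FV 4) (ball 7 (FV 4) (Eq (Var 7) (Var 5))))
      (And decoding_fm (bex 5 (Var 3) (And (Mem (Var 4) (Var 5)) (bex 7 (Var 5) (Neg (IsUr (Var 7)))))))))"
  have \<psi>: "\<psi> \<in> Delta0" unfolding \<psi>_def by (intro Delta0_intros decoding_fm) auto
  have sat_\<psi>: "sat \<AA> \<psi> (s(4 := p, 3 := r)) \<longleftrightarrow> p = Ur zero \<or> p = Ur two \<or>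
    (\<exists>q. m q (F p) \<and> (\<forall>q'. m q' (F p) \<longrightarrow> q' = q)) \<or>
    (decoding r \<and> (\<exists>d. m d r \<and> m p d \<and> (\<exists>x. m x d \<and> x \<notin> range Ur)))" for p r
    unfolding \<psi>_def using s12 by simp
  have "\<exists>c\<in>asets \<AA>. \<forall>p. m p ?a \<longrightarrow> (\<exists>r. m r c \<and> sat \<AA> \<psi> (s(4 := p, 3 := r)))"
  proof (rule collectionA[where s = s, OF \<psi> s a])
    fix p
    assume "m p ?a"
    then obtain y where y: "p = Ur y" "E y z" by auto
    show "\<exists>r\<in>dmn \<AA>. sat \<AA> \<psi> (s(4 := p, 3 := r))"
    proof (cases "y = zero \<or> y = two")
      case True
      then show ?thesis unfolding sat_\<psi> using y(1) Ur_dmn by blast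
    next
      case False
      then have "cmem y z" using y set.hyps by (simp add: cmem_def)
      from set.IH[OF this] obtain r x where r: "r \<in> dmn \<AA>" "decoding r" "decodes r (Ur y) x" by blast
      then have "sat \<AA> \<psi> (s(4 := p, 3 := r))"
        unfolding sat_\<psi> decodes_def y(1) by blast
      then show ?thesis using r(1) by blast
    qed
  qed simp
  then obtain c where c: "c \<in> asets \<AA>" "\<And>p. m p ?a \<Longrightarrow> \<exists>r. m r c \<and> sat \<AA> \<psi> (s(4 := p, 3 := r))" by blast
  obtain c' where c': "c' \<in> asets \<AA>" "\<And>r. m r c' \<longleftrightarrow> m r c \<and> decoding r"
    using separationA[where s = s and i = 3, OF decoding_fm s c(1)] s12 by auto
  obtain r where r: "r \<in> asets \<AA>" "\<And>d. m d r \<longleftrightarrow> (\<exists>w. m w c \<and> decoding w \<and> m d w)"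
    using unionA[OF c'(1)] c'(2) by auto
  have dec_r: "decoding r"
    unfolding decoding_def
  proof (intro allI impI)
    fix d p x
    assume d: "m d r" "m p d" "m x d" "p \<in> range Ur \<and> x \<notin> range Ur"
    then obtain w where w: "m w c" "decoding w" "m d w" using r(2) by blast
    then have mono: "decodes w p' x' \<Longrightarrow> decodes r p' x'" for p' x'
      using r(2) by (intro decoding_mono[of w r]) blast+
    note * = w(2)[unfolded decoding_def, rule_format, OF w(3) d(2-4)]
    show "m (Ur zero) (F p) \<and> m (Ur two) (F p) \<and>
     (\<forall>p'. m p' (F p) \<longrightarrow> p' = Ur zero \<or> p' = Ur two \<or> (\<exists>x'. m x' x \<and> decodes r p' x')) \<and>
     (\<forall>x'. m x' x \<longrightarrow> (\<exists>p'. m p' (F p) \<and> p' \<noteq> Ur zero \<and> p' \<noteq> Ur two \<and> decodes r p' x'))"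
      using * mono by meson
  qed
  have decodes_r: "\<exists>x\<in>dmn \<AA>. decodes r (Ur y) x" if y: "cmem y z" for y
  proof -
    have ya: "m (Ur y) ?a" "Ur y \<noteq> (Ur zero :: ('m, 'k) V)" "Ur y \<noteq> (Ur two :: ('m, 'k) V)"
      using y by (auto simp: cmem_def)
    from c(2)[OF ya(1)] obtain w where w: "m w c" "sat \<AA> \<psi> (s(4 := Ur y, 3 := w))" by blast
    from w(2) ya(2,3) have "(\<exists>q. m q (F (Ur y)) \<and> (\<forall>q'. m q' (F (Ur y)) \<longrightarrow> q' = q)) \<or>
      (decoding w \<and> (\<exists>d. m d w \<and> m (Ur y) d \<and> (\<exists>x. m x d \<and> x \<notin> range Ur)))"
      unfolding sat_\<psi> by (simp del: m_F_Ur)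
    then consider q where "m q (F (Ur y))" "\<forall>q'. m q' (F (Ur y)) \<longrightarrow> q' = q"
      | d x where "decoding w" "m d w" "m (Ur y) d" "m x d" "x \<notin> range Ur"
      by (elim disjE exE conjE)
    then show ?thesis
    proof cases
      case 1
      moreover from 1(1) have "q \<in> range Ur" unfolding m_F_Ur by blast
      ultimately have "decodes r (Ur y) q" unfolding decodes_def by blast
      then show ?thesis using m_dmn 1(1) by blast
    next
      case 2
      then have "decodes r (Ur y) x" unfolding decodes_def using r(2) w(1) by blast
      then show ?thesis using m_dmn 2(4) by blast
    qed
  qed
  \<comment> \<open>Now that one \<open>r\<close> decodes all elements of \<open>z\<close>, a second
    use of Collection gathers the values; the markers again need a trivial case.\<close>
  define \<chi> :: "fsym fm" where
    "\<chi> = Disj (Eq (Var 4) (Var 1)) (Disj (Eq (Var 4) (Var 2)) (decodes_fm 3 4 5))"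
  have \<chi>: "\<chi> \<in> Delta0" unfolding \<chi>_def by (intro Delta0_intros decodes_fm) auto
  have sat_\<chi>: "sat \<AA> \<chi> (s(3 := r, 4 := p, 5 := x)) \<longleftrightarrow> p = Ur zero \<or> p = Ur two \<or> decodes r p x" for p x
    unfolding \<chi>_def using s12 by simp
  have s3: "(s(3 := r)) i \<in> dmn \<AA>" for i using s r(1) by (simp add: asets_iff)
  have "\<exists>c\<in>asets \<AA>. \<forall>p. m p ?a \<longrightarrow> (\<exists>x. m x c \<and> sat \<AA> \<chi> (s(3 := r, 4 := p, 5 := x)))"
  proof (rule collectionA[where s = "s(3 := r)", OF \<chi> s3 a])
    fix p
    assume "m p ?a"
    then obtain y where y: "p = Ur y" "E y z" by auto
    show "\<exists>x\<in>dmn \<AA>. sat \<AA> \<chi> (s(3 := r, 4 := p, 5 := x))"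
    proof (cases "y = zero \<or> y = two")
      case True
      then show ?thesis unfolding sat_\<chi> using y(1) Ur_dmn by blast
    next
      case False
      then have "cmem y z" using y set.hyps by (simp add: cmem_def)
      then show ?thesis using decodes_r unfolding sat_\<chi> y(1) by blast
    qed
  qed simp
  then obtain e where e: "e \<in> asets \<AA>" "\<And>p. m p ?a \<Longrightarrow> \<exists>x. m x e \<and> sat \<AA> \<chi> (s(3 := r, 4 := p, 5 := x))"
    by blast
  \<comment> \<open>The collected set may have surplus elements; this condition leaves exactly the
    values of proper elements of \<open>z\<close>.\<close>
  define \<theta> :: "fsym fm" where "\<theta> = bex 4 (FV 6) (And (Neg (Eq (Var 4) (Var 1)))
    (And (Neg (Eq (Var 4) (Var 2))) (decodes_fm 3 4 5)))"
  have "\<theta> \<in> Delta0" unfolding \<theta>_def by (intro Delta0_intros decodes_fm) auto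
  from separationA[where s = "s(3 := r)" and i = 5, OF this s3 e(1)] obtain X where X: "X \<in> asets \<AA>"
    "\<And>x. m x X \<longleftrightarrow> m x e \<and> (\<exists>p. m p ?a \<and> p \<noteq> Ur zero \<and> p \<noteq> Ur two \<and> decodes r p x)"
    unfolding \<theta>_def using s12 by auto
  have e': "\<exists>x. m x e \<and> decodes r p x" if "m p ?a" "p \<noteq> Ur zero" "p \<noteq> Ur two" for p
    using e(2)[OF that(1)] that(2,3) unfolding sat_\<chi> by blast
  have zX: "Ur z \<in> dmn \<AA>" "X \<in> dmn \<AA>" "X \<notin> range Ur" using X(1) by (simp_all add: asets_iff)
  \<comment> \<open>The new pair joins the urelement \<open>Ur z\<close> with the set
    \<open>X\<close>; the next three sets only serve to add it to \<open>r\<close>.\<close>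
  obtain d where d: "d \<in> asets \<AA>" "\<And>y. m y d \<longleftrightarrow> y = Ur z \<or> y = X" using pairA[OF zX(1,2)] by blast
  obtain d' where d': "d' \<in> asets \<AA>" "\<And>y. m y d' \<longleftrightarrow> y = d"
    using pairA[of d d] d(1) by (auto simp: asets_iff)
  obtain r2 where r2: "r2 \<in> asets \<AA>" "\<And>y. m y r2 \<longleftrightarrow> y = r \<or> y = d'"
    using pairA[of r d'] r(1) d'(1) by (auto simp: asets_iff)
  obtain r' where r': "r' \<in> asets \<AA>" "\<And>y. m y r' \<longleftrightarrow> m y r \<or> y = d"
    using unionA[OF r2(1)] unfolding r2(2) using d'(2) by metis
  have mono: "decodes r p x \<Longrightarrow> decodes r' p x" for p x
    by (rule decoding_mono[of r]) (use r'(2) in blast)+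
  have "decoding r'"
    unfolding decoding_def
  proof (intro allI impI)
    fix b p x
    assume b: "m b r'" "m p b" "m x b" "p \<in> range Ur \<and> x \<notin> range Ur"
    show "m (Ur zero) (F p) \<and> m (Ur two) (F p) \<and>
     (\<forall>p'. m p' (F p) \<longrightarrow> p' = Ur zero \<or> p' = Ur two \<or> (\<exists>x'. m x' x \<and> decodes r' p' x')) \<and>
     (\<forall>x'. m x' x \<longrightarrow> (\<exists>p'. m p' (F p) \<and> p' \<noteq> Ur zero \<and> p' \<noteq> Ur two \<and> decodes r' p' x'))"
    proof (cases "m b r")
      case True
      note * = dec_r[unfolded decoding_def, rule_format, OF True b(2-4)]
      then show ?thesis using mono by meson
    next
      case False
      then have "b = d" using b(1) r'(2) by blast
      then have px: "p = Ur z" "x = X" using b(2-4) d(2) zX(3) by auto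
      have "\<exists>x'. m x' X \<and> decodes r' p' x'" if "m p' ?a" "p' \<noteq> Ur zero" "p' \<noteq> Ur two" for p'
        using e'[OF that] that X(2) mono by blast
      moreover have "\<exists>p'. m p' ?a \<and> p' \<noteq> Ur zero \<and> p' \<noteq> Ur two \<and> decodes r' p' x'" if "m x' X" for x'
        using that X(2) mono by blast
      ultimately show ?thesis unfolding px using z m_F_Ur by blast
    qed
  qed
  moreover have "decodes r' (Ur z) X" unfolding decodes_def using zX(3) r'(2) d(2) by blast
  ultimately show ?case using r'(1) zX(2) by (auto simp: asets_iff)
qed

lemma obj_dmn: "coded z \<Longrightarrow> obj z \<in> dmn \<AA>"
  using decodes_exists decodes_obj by metis

lemma asets_cov_subset: "asets (cov :: (fsym, ('m, 'k) V) astruct) \<subseteq> asets \<AA>"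
proof
  fix x :: "('m, 'k) V"
  assume "x \<in> asets cov"
  then obtain z where z: "x = obj z" "coded z" "setcode z" unfolding cov_def asets_cover by blast
  then have "x \<notin> range Ur" using obj_setcode[OF z(2), where 'k = 'k] by simp
  then show "x \<in> asets \<AA>" using obj_dmn[OF z(2)] z(1) by (simp add: asets_iff)
qed

end

theorem theorem4p9:
  fixes E :: "'m \<Rightarrow> 'm \<Rightarrow> bool"
  assumes "KP E"
    and "Powerset E"
    and "L_Collection E LDelta0P"
    and "L_Foundation E LSigma1P"
  shows "\<exists>\<AA> :: (fsym, ('m, 'k) V) astruct.
           is_Cov E \<AA> \<and> (\<exists>P. is_CovP E (expand \<AA> P))"
proof -
  interpret model E using assms by unfold_locales
  have minimal: "asets (cov :: (fsym, ('m, 'k) V) astruct) \<subseteq> asets \<BB>"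
    if "standard_over E \<BB>" "admissible \<BB>" for \<BB> :: "(fsym, ('m, 'k) V) astruct"
  proof -
    interpret admissible_over E \<BB> using that by unfold_locales
    show ?thesis by (rule asets_cov_subset)
  qed
  have "is_Cov E (cov :: (fsym, ('m, 'k) V) astruct)"
    unfolding is_Cov_def using minimal admissible_cov standard_over_cover by (auto simp: cov_def)
  moreover have "is_CovP E (expand cov P_of :: (fsymP, ('m, 'k) V) astruct)"
    unfolding is_CovP_def
  proof (intro conjI allI impI)
    fix \<BB> :: "(fsymP, ('m, 'k) V) astruct"
    assume \<BB>: "standard_over E \<BB> \<and> power_admissible \<BB>"
    \<comment> \<open>Forgetting the power set operation leaves an admissible set with the same
      sets, so minimality carries over from the smaller language.\<close>
    have "standard_over E (reduct \<BB>)" using \<BB> by (simp add: standard_over_def reduct_def)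
    moreover have "admissible (reduct \<BB>)"
      using \<BB> unfolding power_admissible_def KPUP_Cov_def admissible_def
      by (auto simp: reduct_def is_structure_def asets_def)
    ultimately have "asets (cov :: (fsym, ('m, 'k) V) astruct) \<subseteq> asets (reduct \<BB>)" by (rule minimal)
    then show "asets (expand cov P_of) \<subseteq> asets \<BB>" by (simp add: asets_def reduct_def expand_def)
  next
    show "standard_over E (expand cov P_of :: (fsymP, ('m, 'k) V) astruct)"
      unfolding expand_cov by (rule standard_over_cover)
    show "fn (expand cov P_of :: (fsymP, ('m, 'k) V) astruct) (Base F_sym) = F_of E"
      by (simp add: expand_cov)
  qed (rule power_admissible_cov)
  ultimately show ?thesis by blast
qed

end
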